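(* Let $\mathfrak{g}$ be a finite dimensional complex quadratic Lie algebra with bilinear form $B$. Any invariant cyclic cochain is a cocycle. If $\mathfrak{g}$ is reductive, any cyclic cohomology class contains one, and only one, invariant cyclic cocycle (for instance, the only invariant cyclic coboundary is $0$).
   Context: A quadratic Lie algebra is a Lie algebra with a non degenerate symmetric invariant bilinear form $B$. $\mathcal{M}_a^0(\mathfrak{g})=\mathfrak{g}$, and for $k\ge1$, $\mathcal{M}_a^k(\mathfrak{g})$ is the space of skew symmetric $k$-linear maps $\mathfrak{g}^k\to\mathfrak{g}$; $d$ is the Chevalley differential of $\mathfrak{g}$ with coefficients in the adjoint representation on $\mathcal{M}_a(\mathfrak{g})=\sum_k\mathcal{M}_a^k(\mathfrak{g})$. For $C\in\mathcal{M}_a^k(\mathfrak{g})$, $\hat C(Y_1,\dots,Y_{k+1})=B(C(Y_1,\dots,Y_k),Y_{k+1})$ ($\hat C(Y)=B(C,Y)$ if $k=0$). $C$ is a cyclic cochain if $\hat C(Y_1,\dots,Y_{k+1})=(-1)^k\hat C(Y_{k+1},Y_1,\dots,Y_k)$ for all $Y_i\in\mathfrak{g}$. Cyclic cochains form a subcomplex $\mathcal{C}_c(\mathfrak{g})$ of $(\mathcal{M}_a(\mathfrak{g}),d)$; its cohomology is the cyclic cohomology $H_c^*(\mathfrak{g})$, and cyclic cocycles/coboundaries are the cocycles/coboundaries of this subcomplex. Invariance refers to the $\mathfrak{g}$-action $(L_XC)(Y_1,\dots,Y_k)=[X,C(Y_1,\dots,Y_k)]-\sum_iC(Y_1,\dots,[X,Y_i],\dots,Y_k)$;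 $C$ is invariant if $L_XC=0$ for all $X\in\mathfrak{g}$. *)

theory Defs
  imports Complex_Main
begin

locale lie_algebra = vector_space scale
  for scale :: "complex \<Rightarrow> 'a::ab_group_add \<Rightarrow> 'a" +
  fixes bracket :: "'a \<Rightarrow> 'a \<Rightarrow> 'a"
  assumes linear_bracket_left: "Vector_Spaces.linear scale scale (\<lambda>x. bracket x y)"
    and linear_bracket_right: "Vector_Spaces.linear scale scale (\<lambda>y. bracket x y)"
    and bracket_self: "bracket x x = 0"
    and jacobi:
      "bracket x (bracket y z) + bracket y (bracket z x) + bracket z (bracket x y) = 0"

locale quadratic_lie_algebra = lie_algebra scale bracket
  for scale :: "complex \<Rightarrow> 'a::ab_group_add \<Rightarrow> 'a" and bracket :: "'a \<Rightarrow> 'a \<Rightarrow> 'a" +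
  fixes B :: "'a \<Rightarrow> 'a \<Rightarrow> complex"
  assumes linear_form_left: "Vector_Spaces.linear scale (*) (\<lambda>x. B x y)"
    and linear_form_right: "Vector_Spaces.linear scale (*) (\<lambda>y. B x y)"
    and form_sym: "B x y = B y x"
    and form_invariant: "B (bracket x y) z = B x (bracket y z)"
    and form_nondegenerate: "(\<And>y. B x y = 0) \<Longrightarrow> x = 0"

definition lie_ideal ::
  "(complex \<Rightarrow> 'a::ab_group_add \<Rightarrow> 'a) \<Rightarrow> ('a \<Rightarrow> 'a \<Rightarrow> 'a) \<Rightarrow> 'a set \<Rightarrow> bool" where
  "lie_ideal scale bracket I \<longleftrightarrow>
     module.subspace scale I \<and> (\<forall>x. \<forall>y\<in>I. bracket x y \<in> I)"

text \<open>Reductive means that the adjoint representation is semisimple: its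
  subrepresentations are the ideals, and each of them has a complementary one.\<close>

definition reductive ::
  "(complex \<Rightarrow> 'a::ab_group_add \<Rightarrow> 'a) \<Rightarrow> ('a \<Rightarrow> 'a \<Rightarrow> 'a) \<Rightarrow> bool" where
  "reductive scale bracket \<longleftrightarrow>
     (\<forall>I. lie_ideal scale bracket I \<longrightarrow>
        (\<exists>J. lie_ideal scale bracket J \<and> I \<inter> J = {0} \<and> (\<forall>x. \<exists>y\<in>I. \<exists>z\<in>J. x = y + z)))"

text \<open>A \<open>k\<close>-linear map is a function on lists, meaningful on lists of length \<open>k\<close>. It is
  required to vanish on all other lists, so that equality of functions is equality of maps.
  For \<open>k = 0\<close> such a function is determined by its value at \<open>[]\<close>, an arbitrary vector.\<close>

definition cochains ::
  "(complex \<Rightarrow> 'a::ab_group_add \<Rightarrow> 'a) \<Rightarrow> nat \<Rightarrow> ('a list \<Rightarrow> 'a) set" where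
  "cochains scale k = {C.
     (\<forall>ys. length ys \<noteq> k \<longrightarrow> C ys = 0) \<and>
     (\<forall>ys i. length ys = k \<longrightarrow> i < k \<longrightarrow>
        Vector_Spaces.linear scale scale (\<lambda>y. C (ys[i := y]))) \<and>
     (\<forall>ys i j. length ys = k \<longrightarrow> i < j \<longrightarrow> j < k \<longrightarrow>
        C (ys[i := ys ! j, j := ys ! i]) = - C ys)}"

definition omit :: "nat \<Rightarrow> 'b list \<Rightarrow> 'b list" where
  "omit i ys = take i ys @ drop (Suc i) ys"

text \<open>With positions counted from 0,
  \<open>(dC)(Y\<^sub>0,\<dots>,Y\<^sub>k)\<close> is the sum of the \<open>(-1)\<^sup>i [Y\<^sub>i, C(\<dots>)]\<close>, where \<open>Y\<^sub>i\<close> is omitted, and of the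
  \<open>(-1)\<^sup>i\<^sup>+\<^sup>j C([Y\<^sub>i,Y\<^sub>j],\<dots>)\<close> for \<open>i < j\<close>, where \<open>Y\<^sub>i\<close> and \<open>Y\<^sub>j\<close> are omitted. The degree need not
  be an argument: every list to which \<open>C\<close> is applied is one shorter than \<open>ys\<close>.\<close>

definition chevalley_d ::
  "(complex \<Rightarrow> 'a::ab_group_add \<Rightarrow> 'a) \<Rightarrow> ('a \<Rightarrow> 'a \<Rightarrow> 'a) \<Rightarrow>
     ('a list \<Rightarrow> 'a) \<Rightarrow> 'a list \<Rightarrow> 'a" where
  "chevalley_d scale bracket C ys =
     (\<Sum>i<length ys. scale ((- 1) ^ i) (bracket (ys ! i) (C (omit i ys)))) +
     (\<Sum>j<length ys. \<Sum>i<j.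
        scale ((- 1) ^ (i + j)) (C (bracket (ys ! i) (ys ! j) # omit i (omit j ys))))"

definition lie_action ::
  "('a::ab_group_add \<Rightarrow> 'a \<Rightarrow> 'a) \<Rightarrow> 'a \<Rightarrow> ('a list \<Rightarrow> 'a) \<Rightarrow> 'a list \<Rightarrow> 'a" where
  "lie_action bracket x C ys =
     bracket x (C ys) - (\<Sum>i<length ys. C (ys[i := bracket x (ys ! i)]))"

definition invariant_cochain ::
  "('a::ab_group_add \<Rightarrow> 'a \<Rightarrow> 'a) \<Rightarrow> ('a list \<Rightarrow> 'a) \<Rightarrow> bool" where
  "invariant_cochain bracket C \<longleftrightarrow> (\<forall>x. lie_action bracket x C = (\<lambda>_. 0))"

text \<open>Only used on nonempty lists.\<close>

definition hat :: "('a \<Rightarrow> 'a \<Rightarrow> complex) \<Rightarrow> ('a list \<Rightarrow> 'a) \<Rightarrow> 'a list \<Rightarrow> complex" where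
  "hat B C ys = B (C (butlast ys)) (last ys)"

definition cyclic_cochains ::
  "(complex \<Rightarrow> 'a::ab_group_add \<Rightarrow> 'a) \<Rightarrow> ('a \<Rightarrow> 'a \<Rightarrow> complex) \<Rightarrow> nat \<Rightarrow> ('a list \<Rightarrow> 'a) set" where
  "cyclic_cochains scale B k = {C \<in> cochains scale k.
     \<forall>ys. length ys = k + 1 \<longrightarrow> hat B C ys = (- 1) ^ k * hat B C (last ys # butlast ys)}"

definition cyclic_cocycles ::
  "(complex \<Rightarrow> 'a::ab_group_add \<Rightarrow> 'a) \<Rightarrow> ('a \<Rightarrow> 'a \<Rightarrow> 'a) \<Rightarrow> ('a \<Rightarrow> 'a \<Rightarrow> complex) \<Rightarrow>
     nat \<Rightarrow> ('a list \<Rightarrow> 'a) set" where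
  "cyclic_cocycles scale bracket B k =
     {C \<in> cyclic_cochains scale B k. chevalley_d scale bracket C = (\<lambda>_. 0)}"

definition cyclic_coboundaries ::
  "(complex \<Rightarrow> 'a::ab_group_add \<Rightarrow> 'a) \<Rightarrow> ('a \<Rightarrow> 'a \<Rightarrow> 'a) \<Rightarrow> ('a \<Rightarrow> 'a \<Rightarrow> complex) \<Rightarrow>
     nat \<Rightarrow> ('a list \<Rightarrow> 'a) set" where
  "cyclic_coboundaries scale bracket B k =
     (case k of 0 \<Rightarrow> {\<lambda>_. 0} | Suc j \<Rightarrow> chevalley_d scale bracket ` cyclic_cochains scale B j)"

definition cyclic_cohomologous ::
  "(complex \<Rightarrow> 'a::ab_group_add \<Rightarrow> 'a) \<Rightarrow> ('a \<Rightarrow> 'a \<Rightarrow> 'a) \<Rightarrow> ('a \<Rightarrow> 'a \<Rightarrow> complex) \<Rightarrow>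
     nat \<Rightarrow> (('a list \<Rightarrow> 'a) \<times> ('a list \<Rightarrow> 'a)) set" where
  "cyclic_cohomologous scale bracket B k =
     {(C, D). C \<in> cyclic_cocycles scale bracket B k \<and> D \<in> cyclic_cocycles scale bracket B k \<and>
        (\<lambda>ys. C ys - D ys) \<in> cyclic_coboundaries scale bracket B k}"

definition cyclic_cohomology ::
  "(complex \<Rightarrow> 'a::ab_group_add \<Rightarrow> 'a) \<Rightarrow> ('a \<Rightarrow> 'a \<Rightarrow> 'a) \<Rightarrow> ('a \<Rightarrow> 'a \<Rightarrow> complex) \<Rightarrow>
     nat \<Rightarrow> ('a list \<Rightarrow> 'a) set set" where
  "cyclic_cohomology scale bracket B k =
     cyclic_cocycles scale bracket B k // cyclic_cohomologous scale bracket B k"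

end

theory Submission
  imports Defs "HOL-Library.Function_Algebras" "HOL-Computational_Algebra.Fundamental_Theorem_Algebra"
begin

text \<open>
  Write \<open>\<iota>\<^sub>x\<close> for insertion of \<open>x\<close> as first argument. Cartan's formula \<open>L\<^sub>x = d \<iota>\<^sub>x + \<iota>\<^sub>x d\<close> shows that
  the Lie algebra acts trivially on cyclic cohomology.

  For an invariant cochain \<open>C\<close>, the alternating sum of the terms \<open>[Y\<^sub>i, C(\<dots>)]\<close> is \<open>2 dC\<close>; paired by
  \<open>B\<close> with \<open>Z\<close> and rotated with cyclicity it becomes, up to sign, \<open>L\<^sub>Z C\<close> paired with the last
  argument, which is 0. So \<open>dC = 0\<close>.

  If the Lie algebra is reductive, every finite-dimensional module \<open>V\<close> on which the centre acts
  trivially is the direct sum of its invariants and of the span \<open>g V\<close> of all vectors \<open>x v\<close>. Applied to the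
  cyclic cocycles this gives existence, since \<open>L\<^sub>x C = d \<iota>\<^sub>x C\<close> for a cocycle \<open>C\<close>. If \<open>d \<eta>\<close> is invariant,
  the invariant part of \<open>\<eta>\<close> is closed, so \<open>d \<eta>\<close> lies in \<open>g V\<close> with \<open>V\<close> the cyclic cochains, and hence is 0.

  The decomposition of \<open>V\<close> is proved by induction on its dimension. If the action is nontrivial, the
  trace form of \<open>V\<close> is nonzero by Cartan's criterion and Engel's theorem. The associated Casimir
  operator then has nonzero trace; its Fitting decomposition splits off a submodule contained in
  \<open>g V\<close> and without invariants.
\<close>

section \<open>Linear operators on complex vector spaces\<close>

text \<open>The operator theory is applied to the Lie algebra under \<open>bracket x\<close>, to
  modules and to spaces of functions on lists. The ambient space may have infinite dimension, so
  finiteness is stated for a subspace \<open>U\<close>.\<close>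

locale complex_space = vector_space scale
  for scale :: "complex \<Rightarrow> 'b::ab_group_add \<Rightarrow> 'b"  (infixr \<open>*s\<close> 75)
begin

abbreviation lin :: "('b \<Rightarrow> 'b) \<Rightarrow> bool" where
  "lin T \<equiv> Vector_Spaces.linear scale scale T"

lemma linI: "(\<And>x y. T (x + y) = T x + T y) \<Longrightarrow> (\<And>c x. T (c *s x) = c *s T x) \<Longrightarrow> lin T"
  by (simp add: Vector_Spaces.linear_iff vector_space_axioms)

lemma lin_add: "lin T \<Longrightarrow> T (x + y) = T x + T y"
  and lin_scale: "lin T \<Longrightarrow> T (c *s x) = c *s T x"
  by (simp_all add: Vector_Spaces.linear_iff)

lemma lin_diff: "lin T \<Longrightarrow> T (x - y) = T x - T y"
  and lin_zero: "lin T \<Longrightarrow> T 0 = 0"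
  and lin_neg: "lin T \<Longrightarrow> T (- x) = - T x"
  and lin_sum: "lin T \<Longrightarrow> T (sum g A) = (\<Sum>i\<in>A. T (g i))"
  by (simp_all add: module_hom.diff module_hom.zero module_hom.neg module_hom.sum
      flip: module_hom_iff_linear)

lemmas lin_simps = lin_add lin_scale lin_diff lin_zero lin_neg lin_sum

lemma lin_funpow: "lin T \<Longrightarrow> lin (T ^^ n)"
  by (induction n) (auto intro!: linI simp: lin_simps)

lemma funpow_zero: "lin T \<Longrightarrow> (T ^^ n) 0 = 0"
  by (rule lin_zero[OF lin_funpow])

lemma funpow_stable: "(\<And>v. v \<in> U \<Longrightarrow> T v \<in> U) \<Longrightarrow> v \<in> U \<Longrightarrow> (T ^^ n) v \<in> U"
  by (induction n) auto

section \<open>Generalized eigenvectors\<close>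

definition shift :: "('b \<Rightarrow> 'b) \<Rightarrow> complex \<Rightarrow> 'b \<Rightarrow> 'b" where
  "shift T c v = T v - c *s v"

definition gen_eigen :: "('b \<Rightarrow> 'b) \<Rightarrow> complex \<Rightarrow> 'b \<Rightarrow> bool" where
  "gen_eigen T c v \<longleftrightarrow> (\<exists>n. (shift T c ^^ n) v = 0)"

lemma lin_shift: "lin T \<Longrightarrow> lin (shift T c)"
  by (rule linI) (simp_all add: shift_def lin_simps algebra_simps)

lemma shift_stable:
  "subspace U \<Longrightarrow> (\<And>v. v \<in> U \<Longrightarrow> T v \<in> U) \<Longrightarrow> v \<in> U \<Longrightarrow> shift T c v \<in> U"
  by (simp add: shift_def subspace_diff subspace_scale)

lemma gen_eigen_zero: "gen_eigen T c 0"
  unfolding gen_eigen_def by (rule exI[of _ 0]) simp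

lemma gen_eigen_mono: "lin T \<Longrightarrow> (shift T c ^^ n) v = 0 \<Longrightarrow> n \<le> m \<Longrightarrow> (shift T c ^^ m) v = 0"
  using funpow_add[of "m - n" n "shift T c"] funpow_zero[OF lin_shift] by simp

lemma gen_eigen_scale: "lin T \<Longrightarrow> gen_eigen T c v \<Longrightarrow> gen_eigen T c (a *s v)"
  unfolding gen_eigen_def by (metis lin_funpow lin_scale lin_shift scale_zero_right)

lemma gen_eigen_add:
  assumes "lin T" "gen_eigen T c u" "gen_eigen T c v"
  shows "gen_eigen T c (u + v)"
proof -
  obtain m n where "(shift T c ^^ m) u = 0" "(shift T c ^^ n) v = 0"
    using assms unfolding gen_eigen_def by auto
  then have "(shift T c ^^ max m n) u = 0" "(shift T c ^^ max m n) v = 0"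
    using gen_eigen_mono[OF assms(1)] by (metis max.cobounded1 max.cobounded2)+
  then have "(shift T c ^^ max m n) (u + v) = 0"
    by (simp add: lin_add[OF lin_funpow[OF lin_shift[OF assms(1)]]])
  then show ?thesis unfolding gen_eigen_def by blast
qed

lemma subspace_gen_eigen: "lin T \<Longrightarrow> subspace {v. gen_eigen T c v}"
  by (intro subspaceI) (auto simp: gen_eigen_zero gen_eigen_add gen_eigen_scale)

lemma gen_eigen_diff:
  "lin T \<Longrightarrow> gen_eigen T c u \<Longrightarrow> gen_eigen T c v \<Longrightarrow> gen_eigen T c (u - v)"
  using subspace_diff[OF subspace_gen_eigen] by blast

lemma gen_eigen_shift_iff: assumes "lin T" shows "gen_eigen T c (shift T c v) \<longleftrightarrow> gen_eigen T c v"
proof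
  assume "gen_eigen T c (shift T c v)"
  then obtain n where "(shift T c ^^ Suc n) v = 0"
    unfolding gen_eigen_def by (auto simp: funpow_Suc_right simp del: funpow.simps)
  then show "gen_eigen T c v" unfolding gen_eigen_def by blast
next
  assume "gen_eigen T c v"
  then obtain n where n: "(shift T c ^^ n) v = 0" unfolding gen_eigen_def by blast
  show "gen_eigen T c (shift T c v)"
    using gen_eigen_mono[OF assms n le_SucI[OF order_refl]] unfolding gen_eigen_def
    by (auto simp: funpow_Suc_right simp del: funpow.simps)
qed


text \<open>On generalized eigenvectors for \<open>c\<close>, the operator \<open>T - \<mu>\<close>
  is the nonzero scalar \<open>c - \<mu>\<close> plus the nilpotent \<open>T - c\<close>, hence
  invertible. Induction on the nilpotency order builds the preimage inside \<open>U\<close>.\<close>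

lemma gen_eigen_shift_surj:
  assumes T: "lin T" and U: "subspace U" "\<And>v. v \<in> U \<Longrightarrow> T v \<in> U"
    and c: "c \<noteq> \<mu>" and v: "v \<in> U" "gen_eigen T c v"
  shows "\<exists>w\<in>U. shift T \<mu> w = v"
proof -
  have "\<exists>w\<in>U. shift T \<mu> w = v" if "(shift T c ^^ n) v = 0" "v \<in> U" for n v
    using that
  proof (induction n arbitrary: v)
    case 0
    then show ?case using U by (auto intro!: bexI[of _ 0] simp: lin_zero[OF lin_shift[OF T]] subspace_0)
  next
    case (Suc n)
    have "(shift T c ^^ n) (shift T c v) = 0"
      using Suc.prems by (simp add: funpow_Suc_right del: funpow.simps)
    then obtain w where w: "w \<in> U" "shift T \<mu> w = shift T c v"
      using Suc.IH shift_stable[where T = T, OF U Suc.prems(2)] by blast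
    have "shift T \<mu> (v - w) = (c - \<mu>) *s v"
      by (simp add: lin_diff[OF lin_shift[OF T]] w) (simp add: shift_def algebra_simps)
    then have "shift T \<mu> (inverse (c - \<mu>) *s (v - w)) = v"
      using c by (simp add: lin_scale[OF lin_shift[OF T]])
    then show ?case using w Suc.prems U by (meson subspace_diff subspace_scale)
  qed
  then show ?thesis using v unfolding gen_eigen_def by blast
qed

section \<open>Polynomials in an operator, evaluated at a vector\<close>

definition poly_apply :: "('b \<Rightarrow> 'b) \<Rightarrow> complex poly \<Rightarrow> 'b \<Rightarrow> 'b" where
  "poly_apply T p u = fold_coeffs (\<lambda>a w. a *s u + T w) p 0"

lemma poly_apply_0: "poly_apply T 0 u = 0"
  by (simp add: poly_apply_def)

lemma poly_apply_pCons: "lin T \<Longrightarrow> poly_apply T (pCons a p) u = a *s u + T (poly_apply T p u)"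
  by (cases "a = 0 \<and> p = 0") (auto simp: poly_apply_def lin_zero)

lemma poly_apply_add: "lin T \<Longrightarrow> poly_apply T (p + q) u = poly_apply T p u + poly_apply T q u"
  by (induction p q rule: poly_induct2) (simp_all add: poly_apply_0 poly_apply_pCons lin_add algebra_simps)

lemma poly_apply_smult: "lin T \<Longrightarrow> poly_apply T (smult c p) u = c *s poly_apply T p u"
  by (induction p) (simp_all add: poly_apply_0 poly_apply_pCons lin_scale algebra_simps)

lemma poly_apply_diff: "lin T \<Longrightarrow> poly_apply T (p - q) u = poly_apply T p u - poly_apply T q u"
  using poly_apply_add[of T "p - q" q u] by simp

lemma poly_apply_linear_factor:
  "lin T \<Longrightarrow> poly_apply T ([:- c, 1:] * p) u = shift T c (poly_apply T p u)"
  by (simp add: poly_apply_pCons poly_apply_diff poly_apply_smult shift_def)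

lemma poly_apply_monom: "lin T \<Longrightarrow> poly_apply T (monom a n) u = a *s (T ^^ n) u"
  by (induction n) (simp_all add: monom_0 monom_Suc poly_apply_0 poly_apply_pCons lin_simps)

abbreviation fin_dim :: "'b set \<Rightarrow> bool" where
  "fin_dim U \<equiv> \<exists>S. finite S \<and> U \<subseteq> span S"

text \<open>The iterates of \<open>u\<close> stay in the span of a finite set, so some iterate
  depends linearly on the earlier ones; this relation is the polynomial.\<close>

lemma annihilating_poly:
  assumes T: "lin T" and U: "fin_dim U" "\<And>v. v \<in> U \<Longrightarrow> T v \<in> U" and u: "u \<in> U"
  shows "\<exists>p. p \<noteq> 0 \<and> poly_apply T p u = 0"
proof -
  have "\<exists>n. (T ^^ n) u \<in> span ((\<lambda>j. (T ^^ j) u) ` {..<n})"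
  proof (rule ccontr)
    let ?K = "\<lambda>n. (\<lambda>j. (T ^^ j) u) ` {..<n}"
    assume "\<nexists>n. (T ^^ n) u \<in> span (?K n)"
    then have n: "(T ^^ n) u \<notin> span (?K n)" for n by blast
    have K: "independent (?K n) \<and> card (?K n) = n" for n
    proof (induction n)
      case (Suc n)
      have eq: "?K (Suc n) = insert ((T ^^ n) u) (?K n)" by (simp only: lessThan_Suc image_insert)
      have "(T ^^ n) u \<notin> ?K n" using n[of n] by (blast intro: span_base)
      then have "card (?K (Suc n)) = Suc (card (?K n))" unfolding eq by (intro card_insert_disjoint) auto
      moreover have "independent (?K (Suc n))" unfolding eq using independent_insertI[OF n[of n]] Suc by blast
      ultimately show ?case using Suc by simp
    qed (simp add: independent_empty)
    obtain S where S: "finite S" "U \<subseteq> span S" using U(1) by blast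
    have "?K (Suc (card S)) \<subseteq> span S" using funpow_stable[where T = T, OF U(2) u] S by blast
    then show False using independent_span_bound[OF S(1), of "?K (Suc (card S))"] K[of "Suc (card S)"] by simp
  qed
  then obtain n where n: "(T ^^ n) u \<in> span ((\<lambda>j. (T ^^ j) u) ` {..<n})" by blast
  have "\<exists>q. (\<forall>j\<ge>n. coeff q j = 0) \<and> poly_apply T q u = v"
    if "v \<in> span ((\<lambda>j. (T ^^ j) u) ` {..<n})" for v
    using that
  proof (induction rule: span_induct_alt)
    case base
    show ?case by (intro exI[of _ 0]) (simp add: poly_apply_0)
  next
    case (step c x y)
    then obtain q j where "\<forall>j\<ge>n. coeff q j = 0" "poly_apply T q u = y" "x = (T ^^ j) u" "j < n" by blast
    then show ?case
      by (intro exI[of _ "monom c j + q"]) (auto simp: poly_apply_add poly_apply_monom T)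
  qed
  from this[OF n] obtain q where q: "\<forall>j\<ge>n. coeff q j = 0" "poly_apply T q u = (T ^^ n) u" by blast
  have "poly_apply T (monom 1 n + smult (-1) q) u = 0"
    by (simp only: poly_apply_add[OF T] poly_apply_monom[OF T] poly_apply_smult[OF T] q) simp
  \<comment> \<open>All coefficients of \<open>q\<close> are below degree \<open>n\<close>, so the
    leading coefficient 1 survives and the polynomial is nonzero.\<close>
  moreover have "coeff (monom 1 n + smult (-1) q) n = 1" using q(1) by simp
  ultimately show ?thesis by (metis coeff_0 zero_neq_one)
qed

text \<open>Among the nonzero \<open>p\<close> that send a vector outside \<open>W\<close> into
  \<open>W\<close>, take one of least degree. It has a root \<open>c\<close>, and by minimality its
  quotient by the factor \<open>X - c\<close> still sends the vector outside
  \<open>W\<close>.\<close>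

lemma relative_eigenvector:
  assumes T: "lin T" and U: "fin_dim U" "\<And>v. v \<in> U \<Longrightarrow> T v \<in> U" "subspace U"
    and W: "subspace W" "W \<subset> U"
  shows "\<exists>u c. u \<in> U \<and> u \<notin> W \<and> shift T c u \<in> W"
proof -
  obtain u where u: "u \<in> U" "u \<notin> W" using W by blast
  define P where "P p \<longleftrightarrow> p \<noteq> 0 \<and> poly_apply T p u \<in> W" for p
  have "\<exists>p. P p" using annihilating_poly[OF T U(1,2) u(1)] subspace_0[OF W(1)] P_def by auto
  then obtain p where p: "P p" "\<And>q. P q \<Longrightarrow> degree p \<le> degree q"
    using arg_min_nat_lemma[of P _ degree] by auto
  have in_U: "poly_apply T q u \<in> U" for q
    by (induction q) (simp_all add: poly_apply_0 poly_apply_pCons T U u subspace_0 subspace_add subspace_scale)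
  have "degree p \<noteq> 0"
  proof
    assume "degree p = 0"
    then obtain a where a: "p = [:a:]" by (meson degree_eq_zeroE)
    with p(1) have "a \<noteq> 0" "a *s u \<in> W" by (auto simp: P_def poly_apply_pCons T poly_apply_0 lin_zero)
    then show False using subspace_scale[OF W(1), of "a *s u" "inverse a"] u by simp
  qed
  then obtain c where "poly p c = 0"
    using fundamental_theorem_of_algebra[of p] by (auto simp: constant_degree)
  then obtain q where q: "p = [:- c, 1:] * q" by (metis poly_eq_0_iff_dvd dvdE)
  have "p \<noteq> 0" using p(1) by (simp add: P_def)
  then have "q \<noteq> 0" using q by force
  then have "degree q < degree p" unfolding q by (subst degree_mult_eq) auto
  then have "\<not> P q" using p(2)[of q] by linarith
  then have "poly_apply T q u \<notin> W" using \<open>q \<noteq> 0\<close> by (simp add: P_def)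
  moreover have "shift T c (poly_apply T q u) \<in> W"
    using p(1) unfolding P_def q poly_apply_linear_factor[OF T] by blast
  ultimately show ?thesis using in_U by blast
qed

section \<open>Triangular bases of generalized eigenvectors\<close>

text \<open>Lists are read from the right: \<open>triangular T d bs\<close> says that \<open>T\<close> is triangular with diagonal
  \<open>d\<close> in the basis \<open>rev bs\<close>.\<close>

fun triangular :: "('b \<Rightarrow> 'b) \<Rightarrow> ('b \<Rightarrow> complex) \<Rightarrow> 'b list \<Rightarrow> bool" where
  "triangular T d [] \<longleftrightarrow> True"
| "triangular T d (b # bs) \<longleftrightarrow>
     triangular T d bs \<and> b \<notin> span (set bs) \<and> shift T (d b) b \<in> span (set bs)"

lemma triangular_independent: "triangular T d bs \<Longrightarrow> independent (set bs) \<and> distinct bs"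
  by (induction bs) (auto simp: independent_empty span_base dest: dependent_insertD)

lemma triangular_cong: "(\<And>b. b \<in> set bs \<Longrightarrow> d b = d' b) \<Longrightarrow> triangular T d bs = triangular T d' bs"
  by (induction bs) auto

lemma triangular_stable:
  assumes "lin T" "triangular T d bs" "v \<in> span (set bs)"
  shows "T v \<in> span (set bs)"
  using assms(2,3)
proof (induction bs arbitrary: v)
  case Nil
  then show ?case using assms by (auto simp: lin_zero)
next
  case (Cons b bs)
  then obtain k where k: "v - k *s b \<in> span (set bs)" by (auto simp: span_breakdown_eq)
  have sub: "span (set bs) \<subseteq> span (set (b # bs))" by (intro span_mono) auto
  have "T v = T (v - k *s b) + k *s (shift T (d b) b + d b *s b)"
    by (simp add: shift_def lin_simps assms(1))
  moreover have "b \<in> span (set (b # bs))" by (simp add: span_base)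
  ultimately show ?case using Cons k sub
    by (auto intro!: span_add span_scale simp del: set_simps)
qed

text \<open>With zero diagonal, \<open>T\<close> pushes each step of the flag into the previous
  one.\<close>

lemma triangular_nilpotent:
  assumes "lin T" "triangular T d bs" "\<And>b. b \<in> set bs \<Longrightarrow> d b = 0" "v \<in> span (set bs)"
  shows "(T ^^ length bs) v = 0"
  using assms(2-4)
proof (induction bs arbitrary: v)
  case (Cons b bs)
  then obtain k where k: "v - k *s b \<in> span (set bs)" by (auto simp: span_breakdown_eq)
  have "T v = T (v - k *s b) + k *s T b" by (simp add: lin_simps assms(1))
  moreover have "T b \<in> span (set bs)" using Cons.prems by (simp add: shift_def)
  moreover have "T (v - k *s b) \<in> span (set bs)"
    using triangular_stable[OF assms(1) _ k] Cons.prems by auto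
  ultimately have "T v \<in> span (set bs)" by (auto intro!: span_add span_scale)
  then show ?case using Cons by (simp add: funpow_Suc_right del: funpow.simps)
qed auto

text \<open>A longest triangular list of generalized eigenvectors in \<open>U\<close> must span
  \<open>U\<close>: otherwise a relative eigenvector could be corrected to a generalized eigenvector
  and prepended. Generalized eigenvectors, rather than just a flag, are wanted so that operators can
  be defined that are scalar on each generalized eigenspace.\<close>

lemma triangular_basis_exists:
  assumes T: "lin T" and U: "fin_dim U" "\<And>v. v \<in> U \<Longrightarrow> T v \<in> U" "subspace U"
  shows "\<exists>bs d. triangular T d bs \<and> span (set bs) = U \<and> (\<forall>b\<in>set bs. gen_eigen T (d b) b)"
proof -
  define good where "good bs d \<longleftrightarrow> triangular T d bs \<and> set bs \<subseteq> U \<and> (\<forall>b\<in>set bs. gen_eigen T (d b) b)"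
    for bs d
  obtain S where S: "finite S" "U \<subseteq> span S" using U(1) by blast
  have bound: "length bs \<le> card S" if "good bs d" for bs d
    using that independent_span_bound[OF S(1), of "set bs"] triangular_independent[of T d bs] S(2)
    by (auto simp: good_def distinct_card)
  define Q where "Q m \<longleftrightarrow> (\<exists>bs d. good bs d \<and> length bs = m)" for m
  have Q: "Q 0" "\<And>m. Q m \<Longrightarrow> m \<le> card S" using bound by (auto simp: Q_def good_def)
  define n where "n = Greatest Q"
  have n: "Q n" "\<And>m. Q m \<Longrightarrow> m \<le> n"
    unfolding n_def using GreatestI_nat[of Q, OF Q] Greatest_le_nat[of Q _ "card S"] Q(2) by blast+
  from n(1) obtain bs d where bs: "good bs d" "length bs = n" by (auto simp: Q_def)
  let ?W = "span (set bs)"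
  have WU: "?W \<subseteq> U" using bs U(3) by (auto simp: good_def intro: span_minimal[THEN subsetD])
  have stab: "v \<in> ?W \<Longrightarrow> T v \<in> ?W" for v
    using bs triangular_stable[OF T] by (auto simp: good_def)
  have "?W = U"
  proof (rule ccontr)
    assume "?W \<noteq> U"
    then obtain u c where u: "u \<in> U" "u \<notin> ?W" "shift T c u \<in> ?W"
      using relative_eigenvector[OF T U(1,2,3), of ?W] WU by blast
    \<comment> \<open>Up to generalized eigenvectors for \<open>c\<close>, \<open>shift T c\<close>
      is onto \<open>?W\<close>: basis vectors with another eigenvalue are hit exactly, those with
      eigenvalue \<open>c\<close> are absorbed in the error term.\<close>
    have "\<exists>w\<in>?W. gen_eigen T c (v - shift T c w)" if "v \<in> ?W" for v
      using that
    proof (induction rule: span_induct_alt)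
      case base
      show ?case by (rule bexI[of _ 0]) (simp_all add: gen_eigen_zero lin_zero[OF lin_shift[OF T]] span_zero)
    next
      case (step k b y)
      then obtain w where w: "w \<in> ?W" "gen_eigen T c (y - shift T c w)" by blast
      show ?case
      proof (cases "d b = c")
        case True
        then have "gen_eigen T c b" using bs step by (auto simp: good_def)
        then have "gen_eigen T c (k *s b + (y - shift T c w))"
          using gen_eigen_add gen_eigen_scale T w by blast
        then show ?thesis using w by (auto simp: algebra_simps)
      next
        case False
        have "gen_eigen T (d b) b" using bs step by (auto simp: good_def)
        then obtain w' where w': "w' \<in> ?W" "shift T c w' = b"
          using gen_eigen_shift_surj[OF T subspace_span stab False span_base] step by blast
        have "k *s b + y - shift T c (w + k *s w') = y - shift T c w"
          by (simp add: lin_simps[OF lin_shift[OF T]] w')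
        then show ?thesis using w w' by (metis span_add span_scale)
      qed
    qed
    from this[OF u(3)] obtain w where w: "w \<in> ?W" "gen_eigen T c (shift T c u - shift T c w)" by blast
    define b where "b = u - w"
    have b: "gen_eigen T c b" using w(2) unfolding b_def
      by (simp flip: lin_diff[OF lin_shift[OF T]] add: gen_eigen_shift_iff T)
    have "b \<in> U" using u w WU U(3) subspace_diff unfolding b_def by blast
    have bW: "b \<notin> ?W" using u(2) w(1) unfolding b_def by (metis diff_add_cancel span_add)
    have "shift T c b \<in> ?W" unfolding b_def lin_diff[OF lin_shift[OF T]]
      by (intro span_diff u shift_stable[where T = T, OF subspace_span stab w(1)])
    moreover have "b \<notin> set bs" using bW span_base by blast
    moreover have "triangular T (d(b := c)) bs = triangular T d bs"
      by (rule triangular_cong) (use \<open>b \<notin> set bs\<close> in auto)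
    ultimately have "good (b # bs) (d(b := c))" using bs b bW \<open>b \<in> U\<close> by (auto simp: good_def)
    then show False using n(2)[of "Suc n"] bs(2) unfolding Q_def by (metis Suc_n_not_le_n length_Cons)
  qed
  then show ?thesis using bs good_def by blast
qed

text \<open>Modulo the span of \<open>bs\<close>, the \<open>n\<close>-th power of
  \<open>T - c\<close> multiplies the coefficient of \<open>b\<close> by
  \<open>(d b - c) ^ n\<close>, which can vanish only if \<open>d b = c\<close>.\<close>

lemma gen_eigen_diag:
  assumes T: "lin T" and tri: "triangular T d (b # bs)" and v: "gen_eigen T c (k *s b + w)" "w \<in> span (set bs)"
    and "k \<noteq> 0"
  shows "d b = c"
proof -
  have stab: "shift T c x \<in> span (set bs)" if "x \<in> span (set bs)" for x
    by (rule shift_stable[where T = T, OF subspace_span triangular_stable[OF T] that]) (use tri in auto)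
  have *: "(shift T c ^^ n) (k *s b + w) - ((d b - c) ^ n * k) *s b \<in> span (set bs)" for n
  proof (induction n)
    case (Suc n)
    let ?x = "(shift T c ^^ n) (k *s b + w)" and ?a = "(d b - c) ^ n * k"
    have "shift T c ?x - ((d b - c) * ?a) *s b = shift T c (?x - ?a *s b) + ?a *s shift T (d b) b"
      by (simp add: lin_simps[OF lin_shift[OF T]]) (simp add: shift_def algebra_simps)
    then show ?case using stab[OF Suc] tri by (auto intro!: span_add span_scale simp: mult.assoc)
  qed (use v in simp)
  obtain n where "(shift T c ^^ n) (k *s b + w) = 0" using v gen_eigen_def by blast
  then have "- (((d b - c) ^ n * k) *s b) \<in> span (set bs)" using *[of n] by simp
  then have "((d b - c) ^ n * k) *s b \<in> span (set bs)" using span_neg by fastforce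
  then have "inverse ((d b - c) ^ n * k) *s (((d b - c) ^ n * k) *s b) \<in> span (set bs)"
    by (rule span_scale)
  moreover have "inverse ((d b - c) ^ n * k) * ((d b - c) ^ n * k) = 1" if "d b \<noteq> c"
    using that \<open>k \<noteq> 0\<close> by (intro left_inverse) simp
  ultimately show ?thesis using tri by (metis scale_one scale_scale triangular.simps(2))
qed

text \<open>A generalized eigenvector for \<open>c\<close> that involves \<open>b\<close> forces
  \<open>d b = c\<close>, so its \<open>b\<close>-part can be split off without leaving the
  generalized eigenspace. Two maps rely on this: the conjugation of eigenvalues in Cartan's
  criterion and the Fitting projection.\<close>

lemma diagonal_on_gen_eigen:
  assumes T: "lin T" and tri: "triangular T d bs" and gen: "\<And>b. b \<in> set bs \<Longrightarrow> gen_eigen T (d b) b"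
    and y: "lin y" "\<And>b. b \<in> set bs \<Longrightarrow> y b = h (d b) *s b"
    and v: "v \<in> span (set bs)" "gen_eigen T c v"
  shows "y v = h c *s v"
  using tri gen y(2) v
proof (induction bs arbitrary: v)
  case Nil
  then show ?case by (simp add: lin_zero y)
next
  case (Cons b bs)
  then obtain k where k: "v - k *s b \<in> span (set bs)" by (auto simp: span_breakdown_eq)
  have IH: "y w = h c *s w" if "w \<in> span (set bs)" "gen_eigen T c w" for w
    using Cons that by auto
  show ?case
  proof (cases "k = 0")
    case False
    then have "d b = c" using gen_eigen_diag[OF T Cons.prems(1), of c k "v - k *s b"] k Cons.prems(5) by simp
    then have "gen_eigen T c (v - k *s b)"
      using Cons.prems gen_eigen_diff gen_eigen_scale T by auto
    then have "y (v - k *s b) = h c *s (v - k *s b)" using IH k by blast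
    then show ?thesis using Cons.prems(3)[of b] \<open>d b = c\<close> y(1)
      by (simp add: lin_simps scale_right_diff_distrib mult.commute)
  qed (use IH k Cons in auto)
qed

section \<open>Coordinates and traces\<close>

lemma lin_extend:
  assumes "independent S"
  shows "\<exists>y. lin y \<and> (\<forall>b\<in>S. y b = g b)"
proof -
  interpret vector_space_pair scale scale ..
  show ?thesis using linear_independent_extend[OF assms] by blast
qed

text \<open>The coordinates are taken with respect to an extension of \<open>S\<close> to a basis of the whole space,
  so that they are globally linear.\<close>

definition coord :: "'b set \<Rightarrow> 'b \<Rightarrow> 'b \<Rightarrow> complex" where
  "coord S b v = representation (extend_basis S) v b"

definition trace :: "'b set \<Rightarrow> ('b \<Rightarrow> 'b) \<Rightarrow> complex" where
  "trace S f = (\<Sum>b\<in>S. coord S b (f b))"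

lemma coord_linear:
  assumes "independent S"
  shows "coord S b (u + v) = coord S b u + coord S b v" "coord S b (c *s v) = c * coord S b v"
    "coord S b 0 = 0"
  using independent_extend_basis[OF assms] span_extend_basis[OF assms]
  by (simp_all add: coord_def representation_add representation_scale representation_zero)

lemma coord_diff: "independent S \<Longrightarrow> coord S b (u - v) = coord S b u - coord S b v"
  using coord_linear(1)[of S b "u - v" v] by simp

lemma coord_sum: "independent S \<Longrightarrow> coord S b (sum g A) = (\<Sum>i\<in>A. coord S b (g i))"
  by (induction A rule: infinite_finite_induct) (simp_all add: coord_linear)

lemma coord_basis: "independent S \<Longrightarrow> c \<in> S \<Longrightarrow> coord S b c = (if b = c then 1 else 0)"
  using extend_basis_superset[of S] independent_extend_basis[of S]
  by (auto simp: coord_def representation_basis)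

lemma coord_span_other:
  assumes "independent S" "S' \<subseteq> S" "b \<notin> S'" "v \<in> span S'"
  shows "coord S b v = 0"
  using assms(4)
proof (induction rule: span_induct_alt)
  case (step c x y)
  then have "coord S b x = 0" using assms by (auto simp: coord_basis)
  then show ?case using step by (simp add: coord_linear assms(1))
qed (simp add: coord_linear assms(1))

lemma sum_coord:
  assumes "independent S" "finite S" "v \<in> span S"
  shows "(\<Sum>b\<in>S. coord S b v *s b) = v"
  using assms(3)
proof (induction rule: span_induct_alt)
  case (step c x y)
  have "(\<Sum>b\<in>S. (c * coord S b x) *s b) = (\<Sum>b\<in>S. if b = x then c *s b else 0)"
    by (intro sum.cong) (use step assms in \<open>auto simp: coord_basis\<close>)
  also have "\<dots> = c *s x" using step assms by simp
  finally show ?case using step by (simp add: coord_linear assms scale_left_distrib sum.distrib)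
qed (simp add: coord_linear assms)

text \<open>Both sides are the same double sum of products of matrix entries. Two different bases
  are allowed so that independence of the trace from the basis becomes the case where
  \<open>g\<close> is the identity.\<close>

lemma trace_comp_commute:
  assumes S: "independent S" "finite S" and R: "independent R" "finite R"
    and f: "lin f" "\<And>v. v \<in> span R \<Longrightarrow> f v \<in> span S" and g: "lin g" "\<And>v. v \<in> span S \<Longrightarrow> g v \<in> span R"
  shows "trace S (\<lambda>v. f (g v)) = trace R (\<lambda>v. g (f v))"
proof -
  have "trace S (\<lambda>v. f (g v)) = (\<Sum>b\<in>S. \<Sum>c\<in>R. coord R c (g b) * coord S b (f c))"
  proof (unfold trace_def, rule sum.cong[OF refl])
    fix b assume "b \<in> S"
    then have "f (g b) = f (\<Sum>c\<in>R. coord R c (g b) *s c)" using sum_coord[OF R g(2)] span_base by metis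
    then show "coord S b (f (g b)) = (\<Sum>c\<in>R. coord R c (g b) * coord S b (f c))"
      by (simp add: lin_simps f coord_sum coord_linear S)
  qed
  also have "\<dots> = (\<Sum>c\<in>R. \<Sum>b\<in>S. coord S b (f c) * coord R c (g b))"
    by (subst sum.swap) (simp add: mult.commute)
  also have "\<dots> = trace R (\<lambda>v. g (f v))"
  proof (unfold trace_def, rule sum.cong[OF refl])
    fix c assume "c \<in> R"
    then have "g (f c) = g (\<Sum>b\<in>S. coord S b (f c) *s b)" using sum_coord[OF S f(2)] span_base by metis
    then show "(\<Sum>b\<in>S. coord S b (f c) * coord R c (g b)) = coord R c (g (f c))"
      by (simp add: lin_simps g coord_sum coord_linear R)
  qed
  finally show ?thesis .
qed

lemma trace_basis_independent:
  assumes S: "independent S" "finite S" and R: "independent R" "finite R"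
    and f: "lin f" "\<And>v. v \<in> span S \<Longrightarrow> f v \<in> span S" and eq: "span S = span R"
  shows "trace S f = trace R f"
  using trace_comp_commute[OF S R f(1), of "\<lambda>v. v"] f eq by (simp add: linI)

lemma trace_cong: "(\<And>b. b \<in> S \<Longrightarrow> f b = g b) \<Longrightarrow> trace S f = trace S g"
  by (simp add: trace_def)

lemma trace_add: "independent S \<Longrightarrow> trace S (\<lambda>v. f v + g v) = trace S f + trace S g"
  and trace_diff: "independent S \<Longrightarrow> trace S (\<lambda>v. f v - g v) = trace S f - trace S g"
  and trace_scale: "independent S \<Longrightarrow> trace S (\<lambda>v. c *s f v) = c * trace S f"
  and trace_zero: "independent S \<Longrightarrow> trace S (\<lambda>v. 0) = 0"
  by (simp_all add: trace_def coord_linear coord_diff sum.distrib sum_subtractf sum_distrib_left)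

lemma trace_sum: "independent S \<Longrightarrow> trace S (\<lambda>v. \<Sum>i\<in>A. f i v) = (\<Sum>i\<in>A. trace S (f i))"
  unfolding trace_def by (subst sum.swap) (simp add: coord_sum)

lemma trace_triangular:
  assumes "triangular f d bs"
  shows "trace (set bs) f = (\<Sum>b\<leftarrow>bs. d b)"
proof -
  have ind: "independent (set bs)" "distinct bs" using triangular_independent[OF assms] by auto
  have "coord (set bs) b (f b) = d b" if "b \<in> set bs" for b
  proof -
    obtain us vs where bs: "bs = us @ b # vs" using split_list[OF \<open>b \<in> set bs\<close>] by blast
    have "triangular f d (us @ b # vs) \<Longrightarrow> shift f (d b) b \<in> span (set vs)" by (induction us) auto
    then have *: "shift f (d b) b \<in> span (set vs)" using assms bs by auto
    have "coord (set bs) b (shift f (d b) b) = 0"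
      by (rule coord_span_other[OF ind(1) _ _ *]) (use bs ind(2) in auto)
    then show ?thesis using that ind(1) by (simp add: shift_def coord_diff coord_linear coord_basis)
  qed
  then show ?thesis using ind(2) by (simp add: trace_def sum_list_distinct_conv_sum_set)
qed

lemma triangular_append: "triangular T d (us @ vs) \<Longrightarrow> triangular T d vs"
  by (induction us) auto

lemma triangular_gen_eigen_eq:
  assumes "lin T" "triangular T d bs" "b \<in> set bs" "gen_eigen T c b"
  shows "d b = c"
proof -
  obtain us vs where bs: "bs = us @ b # vs" using split_list[OF assms(3)] by blast
  then have "triangular T d (b # vs)" using assms(2) triangular_append by blast
  from gen_eigen_diag[OF assms(1) this, of c 1 0] show ?thesis using assms(4) by (simp add: span_zero)
qed

lemma triangular_comp_diagonal:
  assumes y: "lin y" "\<And>b. b \<in> set bs \<Longrightarrow> y b = h (d b) *s b" and tri: "triangular T d bs"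
  shows "triangular (\<lambda>v. y (T v)) (\<lambda>b. h (d b) * d b) bs"
  using y(2) tri
proof (induction bs)
  case (Cons b bs)
  have "y v \<in> span (set bs)" if "v \<in> span (set bs)" for v
    using that
  proof (induction rule: span_induct_alt)
    case (step c x w)
    then show ?case using Cons.prems(1)[of x]
      by (simp add: lin_simps y(1)) (simp add: span_add span_scale span_base)
  qed (simp add: lin_simps y(1) span_zero)
  moreover have "shift (\<lambda>v. y (T v)) (h (d b) * d b) b = y (shift T (d b) b)"
    using Cons.prems(1)[of b] by (simp add: shift_def lin_simps y(1) mult.commute)
  ultimately show ?case using Cons by simp
qed simp

text \<open>\<open>T\<close> sends \<open>x\<close> to the vector whose coordinates are the pairings
  of \<open>x\<close> with \<open>E\<close>, so a dual basis consists of preimages of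
  \<open>E\<close>. Nondegeneracy makes \<open>T\<close> injective on the span, and surjectivity
  follows because a triangular basis has no zero on its diagonal.\<close>

lemma dual_basis_exists:
  assumes E: "independent E" "finite E"
    and \<beta>: "\<And>f x y. \<beta> (x + y) f = \<beta> x f + \<beta> y f" "\<And>f c x. \<beta> (c *s x) f = c * \<beta> x f"
    and nondeg: "\<And>x. x \<in> span E \<Longrightarrow> (\<And>f. f \<in> E \<Longrightarrow> \<beta> x f = 0) \<Longrightarrow> x = 0"
  shows "\<exists>\<delta>. \<forall>e\<in>E. \<delta> e \<in> span E \<and> (\<forall>f\<in>E. \<beta> (\<delta> e) f = (if f = e then 1 else (0::complex)))"
proof -
  define T where "T x = (\<Sum>f\<in>E. \<beta> x f *s f)" for x
  have T: "lin T"
    by (rule linI) (simp_all add: T_def \<beta> scale_left_distrib sum.distrib scale_sum_right)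
  have T_E: "T x \<in> span E" for x
    unfolding T_def by (intro span_sum span_scale span_base)
  have coord_T: "coord E f (T x) = \<beta> x f" if "f \<in> E" for f x
  proof -
    have "coord E f (T x) = (\<Sum>i\<in>E. if f = i then \<beta> x i else 0)"
      unfolding T_def coord_sum[OF E(1)]
      by (intro sum.cong) (auto simp: coord_linear[OF E(1)] coord_basis[OF E(1)])
    then show ?thesis using that E(2) by simp
  qed
  have inj: "x = 0" if "x \<in> span E" "T x = 0" for x
    by (rule nondeg[OF that(1)]) (metis coord_T that(2) coord_linear(3)[OF E(1)])
  have inj': "x = 0" if "(T ^^ n) x = 0" "x \<in> span E" for n x
    using that
  proof (induction n)
    case (Suc n)
    then show ?case using inj[of "(T ^^ n) x"] funpow_stable[where T = T and U = "span E"] T_E by simp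
  qed auto
  obtain bs d where bs: "triangular T d bs" "span (set bs) = span E" "\<And>b. b \<in> set bs \<Longrightarrow> gen_eigen T (d b) b"
    using triangular_basis_exists[OF T _ T_E subspace_span[of E]] E(2) by blast
  have shift0: "shift T 0 = T" by (simp add: shift_def fun_eq_iff)
  have "\<exists>w\<in>span E. T w = b" if "b \<in> set bs" for b
  proof -
    have bE: "b \<in> span E" using that bs(2) span_base by blast
    have "d b \<noteq> 0"
    proof
      assume "d b = 0"
      then obtain n where "(T ^^ n) b = 0" using bs(3)[OF \<open>b \<in> set bs\<close>] by (auto simp: gen_eigen_def shift0)
      then have "b = 0" using inj' bE by blast
      then show False using that triangular_independent[OF bs(1)] dependent_zero by blast
    qed
    then show ?thesis
      using gen_eigen_shift_surj[OF T subspace_span T_E _ bE bs(3)[OF that], of 0] by (simp add: shift0)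
  qed
  then have surj_bs: "set bs \<subseteq> T ` span E" by blast
  have "subspace (T ` span E)"
  proof (rule subspaceI)
    show "0 \<in> T ` span E" using lin_zero[OF T] span_zero by (metis imageI)
    show "x + y \<in> T ` span E" if "x \<in> T ` span E" "y \<in> T ` span E" for x y
      using that by (auto simp flip: lin_add[OF T] intro: span_add)
    show "c *s x \<in> T ` span E" if "x \<in> T ` span E" for c x
      using that by (auto simp flip: lin_scale[OF T] intro: span_scale)
  qed
  then have "span E \<subseteq> T ` span E" using span_minimal[OF surj_bs] bs(2) by simp
  then have "\<forall>e\<in>E. \<exists>w. w \<in> span E \<and> T w = e" using span_base by blast
  then obtain \<delta> where \<delta>: "\<forall>e\<in>E. \<delta> e \<in> span E \<and> T (\<delta> e) = e" by metis
  have "\<beta> (\<delta> e) f = (if f = e then 1 else 0)" if "e \<in> E" "f \<in> E" for e f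
    using coord_T[OF that(2), of "\<delta> e"] \<delta> that coord_basis[OF E(1)] by simp
  then show ?thesis using \<delta> by blast
qed

section \<open>Finite-dimensional subspaces\<close>

lemma fin_dim_basis_exists:
  assumes "fin_dim U" "subspace U"
  shows "\<exists>S. finite S \<and> independent S \<and> span S = U"
proof -
  obtain S where S: "S \<subseteq> U" "independent S" "U \<subseteq> span S"
    using maximal_independent_subset[of U] by blast
  obtain R where "finite R" "U \<subseteq> span R" using assms(1) by blast
  then have "finite S" using independent_span_bound[of R S] S by blast
  then show ?thesis using S span_subspace assms(2) by blast
qed

lemma dim_less_if_psubset:
  assumes "fin_dim U" "subspace U" "subspace W" "W \<subset> U"
  shows "dim W < dim U"
proof -
  obtain u where u: "u \<in> U" "u \<notin> W" using assms(4) by blast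
  obtain S where S: "finite S" "independent S" "span S = U"
    using fin_dim_basis_exists[OF assms(1,2)] by blast
  have "fin_dim W" using assms(1,4) by blast
  then obtain R where R: "finite R" "independent R" "span R = W"
    using fin_dim_basis_exists assms(3) by blast
  have "u \<notin> R" using u R span_base by blast
  moreover have "independent (insert u R)" using independent_insertI R u by blast
  moreover have "insert u R \<subseteq> span S" using R S u assms(4) span_base by blast
  ultimately have "Suc (card R) \<le> card S"
    using independent_span_bound[OF S(1), of "insert u R"] R by simp
  moreover have "dim W = card R" "dim U = card S"
    using dim_span_eq_card_independent S R by metis+
  ultimately show ?thesis by simp
qed

end

section \<open>Representations of reductive Lie algebras\<close>

sublocale lie_algebra \<subseteq> complex_space scale ..

context lie_algebra
begin

section \<open>Identities for the bracket\<close>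

lemma bracket_add_left: "bracket (x + y) z = bracket x z + bracket y z"
  and bracket_scale_left: "bracket (scale c x) z = scale c (bracket x z)"
  and bracket_add_right: "bracket z (x + y) = bracket z x + bracket z y"
  and bracket_scale_right: "bracket z (scale c x) = scale c (bracket z x)"
  using linear_bracket_left linear_bracket_right by (simp_all add: Vector_Spaces.linear_iff)

lemma lin_bracket: "lin (bracket x)"
  by (rule linear_bracket_right)

lemma bracket_zero_right: "bracket x 0 = 0"
  by (rule lin_zero[OF lin_bracket])

lemma bracket_skew: "bracket x y = - bracket y x"
proof -
  have "bracket x y + bracket y x = 0"
    using bracket_self[of "x + y"] unfolding bracket_add_left bracket_add_right by (simp add: bracket_self add.commute)
  then show ?thesis by (simp add: eq_neg_iff_add_eq_0)
qed

lemma bracket_neg_right: "bracket x (- y) = - bracket x y"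
  by (rule lin_neg[OF lin_bracket])

lemma bracket_diff_right: "bracket x (y - z) = bracket x y - bracket x z"
  by (rule lin_diff[OF lin_bracket])

lemma bracket_bracket_left: "bracket (bracket x y) z = bracket x (bracket y z) - bracket y (bracket x z)"
proof -
  have "bracket (bracket x y) z = - bracket z (bracket x y)" by (rule bracket_skew)
  also have "bracket z (bracket x y) = - (bracket x (bracket y z) + bracket y (bracket z x))"
    using jacobi[of x y z] unfolding eq_neg_iff_add_eq_0 by (simp only: ac_simps)
  also have "bracket y (bracket z x) = - bracket y (bracket x z)"
    by (subst bracket_skew[of z x]) (rule bracket_neg_right)
  finally show ?thesis by simp
qed

section \<open>Subnormal chains and the inductive step of Engel's theorem\<close>

inductive subnormal_chain :: "'a set \<Rightarrow> 'a set \<Rightarrow> bool" for N where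
  base: "subnormal_chain N N"
| step: "subnormal_chain N M \<Longrightarrow> y \<notin> M \<Longrightarrow> (\<And>x. x \<in> M \<Longrightarrow> bracket x y \<in> M) \<Longrightarrow>
    subnormal_chain N (span (insert y M))"

lemma span_insert_subspace:
  "subspace M \<Longrightarrow> x \<in> span (insert y M) \<longleftrightarrow> (\<exists>k m. m \<in> M \<and> x = m + scale k y)"
  by (auto simp: span_breakdown_eq span_eq_iff[THEN iffD2]) (metis diff_add_cancel, metis add_diff_cancel)

text \<open>Each link adds one vector \<open>y\<close> that normalizes \<open>M\<close>. Since
  \<open>[y, y] = 0\<close>, all brackets in the enlarged space fall back into \<open>M\<close>,
  which is thus an ideal of codimension one in it.\<close>

lemma subnormal_chain_subalgebra:
  assumes "subnormal_chain N M" "subspace N" "\<And>x y. x \<in> N \<Longrightarrow> y \<in> N \<Longrightarrow> bracket x y \<in> N"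
  shows "subspace M \<and> N \<subseteq> M \<and> (\<forall>x\<in>M. \<forall>y\<in>M. bracket x y \<in> M)"
  using assms
proof (induction rule: subnormal_chain.induct)
  case (step M y)
  then have M: "subspace M" "N \<subseteq> M" "\<And>x y. x \<in> M \<Longrightarrow> y \<in> M \<Longrightarrow> bracket x y \<in> M" by auto
  have *: "M \<subseteq> span (insert y M)" using span_superset by blast
  have "bracket u v \<in> M" if uv: "u \<in> span (insert y M)" "v \<in> span (insert y M)" for u v
  proof -
    obtain k m l n where "m \<in> M" "n \<in> M" "u = m + scale k y" "v = n + scale l y"
      using uv by (auto simp: span_insert_subspace M)
    moreover have "bracket y n = - bracket n y" by (rule bracket_skew)
    ultimately show ?thesis using M step.hyps(3)
      by (auto simp: bracket_add_left bracket_add_right bracket_scale_left bracket_scale_right bracket_self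
          intro!: subspace_add subspace_scale subspace_neg subspace_diff)
  qed
  then show ?case using * M(2) by blast
qed auto

text \<open>Engel's theorem for the action on \<open>U\<close> modulo \<open>U0\<close>, without
  forming the quotient. It serves twice: for \<open>bracket\<close> modulo a subalgebra, and for a
  representation modulo the annihilated vectors.\<close>

lemma engel_step:
  fixes su :: "complex \<Rightarrow> 'u::ab_group_add \<Rightarrow> 'u" and \<sigma> :: "'a \<Rightarrow> 'u \<Rightarrow> 'u"
  assumes su: "vector_space su" and N: "subspace N" "\<And>x y. x \<in> N \<Longrightarrow> y \<in> N \<Longrightarrow> bracket x y \<in> N"
    and chain: "subnormal_chain N M"
    and U: "\<And>x u. x \<in> M \<Longrightarrow> u \<in> U \<Longrightarrow> \<sigma> x u \<in> U" "U0 \<subset> U"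
    and U0: "module.subspace su U0" "\<And>x u. x \<in> M \<Longrightarrow> u \<in> U0 \<Longrightarrow> \<sigma> x u \<in> U0"
    and N_U: "\<And>x u. x \<in> N \<Longrightarrow> u \<in> U \<Longrightarrow> \<sigma> x u \<in> U0"
    and \<sigma>: "\<And>x y u. u \<in> U \<Longrightarrow> \<sigma> (x + y) u = \<sigma> x u + \<sigma> y u"
      "\<And>c x u. u \<in> U \<Longrightarrow> \<sigma> (scale c x) u = su c (\<sigma> x u)"
      "\<And>x y u. u \<in> U \<Longrightarrow> \<sigma> x (\<sigma> y u) = \<sigma> y (\<sigma> x u) + \<sigma> (bracket x y) u"
    and nil: "\<And>x u. x \<in> M \<Longrightarrow> u \<in> U \<Longrightarrow> \<exists>n. (\<sigma> x ^^ n) u \<in> U0"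
  shows "\<exists>u\<in>U. u \<notin> U0 \<and> (\<forall>x\<in>M. \<sigma> x u \<in> U0)"
proof -
  interpret U: complex_space su using su by (rule complex_space.intro)
  show ?thesis using chain U U0 N_U nil
  proof (induction rule: subnormal_chain.induct)
    case base
    then show ?case by blast
  next
    case (step M y)
    have M: "subspace M" using subnormal_chain_subalgebra[OF step.hyps(1) N] by blast
    have sub: "M \<subseteq> span (insert y M)" "y \<in> span (insert y M)" by (auto intro: span_base)
    have "\<exists>u\<in>U. u \<notin> U0 \<and> (\<forall>x\<in>M. \<sigma> x u \<in> U0)"
      by (rule step.IH) (use sub step.prems in blast)+
    then obtain u where u: "u \<in> U" "u \<notin> U0" "\<And>x. x \<in> M \<Longrightarrow> \<sigma> x u \<in> U0" by blast
    \<comment> \<open>\<open>u\<close> is killed modulo \<open>U0\<close> by the smaller algebra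
      \<open>M\<close>. The iterate of \<open>u\<close> under \<open>y\<close> just before
      \<open>U0\<close> is reached will be killed by \<open>y\<close> as well.\<close>
    define n where "n = (LEAST n. (\<sigma> y ^^ n) u \<in> U0)"
    have n: "(\<sigma> y ^^ n) u \<in> U0" "\<And>m. (\<sigma> y ^^ m) u \<in> U0 \<Longrightarrow> n \<le> m"
      using LeastI_ex[OF step.prems(6)[OF sub(2) u(1)]] Least_le unfolding n_def by fastforce+
    obtain m where m: "n = Suc m" using n(1) u(2) by (cases n) auto
    have in_U: "(\<sigma> y ^^ j) u \<in> U" for j
      by (induction j) (use u step.prems(1) sub(2) in auto)
    \<comment> \<open>The iterates remain killed by \<open>M\<close> modulo \<open>U0\<close>
      because \<open>M\<close> contains \<open>[x, y]\<close> for every \<open>x\<close> in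
      \<open>M\<close>.\<close>
    have M_U: "\<forall>x\<in>M. \<sigma> x ((\<sigma> y ^^ j) u) \<in> U0" for j
    proof (induction j)
      case (Suc j)
      show ?case
      proof
        fix x assume x: "x \<in> M"
        have *: "\<sigma> x ((\<sigma> y ^^ Suc j) u) = \<sigma> y (\<sigma> x ((\<sigma> y ^^ j) u)) + \<sigma> (bracket x y) ((\<sigma> y ^^ j) u)"
          unfolding funpow.simps o_apply by (rule \<sigma>(3)[OF in_U])
        have "\<sigma> y (\<sigma> x ((\<sigma> y ^^ j) u)) \<in> U0" using step.prems(4)[OF sub(2)] Suc x by blast
        moreover have "\<sigma> (bracket x y) ((\<sigma> y ^^ j) u) \<in> U0" using Suc step.hyps(3) x by blast
        ultimately show "\<sigma> x ((\<sigma> y ^^ Suc j) u) \<in> U0"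
          unfolding * by (rule U.subspace_add[OF step.prems(3)])
      qed
    qed (use u in auto)
    let ?u = "(\<sigma> y ^^ m) u"
    have "\<sigma> x ?u \<in> U0" if x: "x \<in> span (insert y M)" for x
    proof -
      obtain k z where z: "z \<in> M" "x = z + scale k y" using x span_insert_subspace[OF M] by blast
      have "\<sigma> y ?u \<in> U0" using n(1) m by simp
      then show ?thesis using z M_U \<sigma>(1,2)[OF in_U]
        by (auto intro!: U.subspace_add U.subspace_scale step.prems(3))
    qed
    moreover have "?u \<notin> U0" using n(2)[of m] m by auto
    ultimately show ?case using in_U by blast
  qed
qed

end

text \<open>The laws of an action are required only on vectors of \<open>V\<close>, so that passing
  to a submodule changes \<open>V\<close> alone. Since the centre of a reductive Lie algebra can act
  non-semisimply in general, it is made to act by 0.\<close>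

locale reductive_rep = lie_algebra sg bracket + finite_dimensional_vector_space sg Basis + V: complex_space sv
  for sg :: "complex \<Rightarrow> 'a::ab_group_add \<Rightarrow> 'a" and bracket :: "'a \<Rightarrow> 'a \<Rightarrow> 'a" and Basis :: "'a set"
    and sv :: "complex \<Rightarrow> 'v::ab_group_add \<Rightarrow> 'v" +
  fixes \<rho> :: "'a \<Rightarrow> 'v \<Rightarrow> 'v" and V :: "'v set"
  assumes reductive: "reductive sg bracket"
    and lin_\<rho>: "V.lin (\<rho> x)"
    and V: "V.subspace V" "V.fin_dim V"
    and \<rho>_stable: "v \<in> V \<Longrightarrow> \<rho> x v \<in> V"
    and \<rho>_add: "v \<in> V \<Longrightarrow> \<rho> (x + y) v = \<rho> x v + \<rho> y v"
    and \<rho>_scale: "v \<in> V \<Longrightarrow> \<rho> (sg c x) v = sv c (\<rho> x v)"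
    and \<rho>_bracket: "v \<in> V \<Longrightarrow> \<rho> (bracket x y) v = \<rho> x (\<rho> y v) - \<rho> y (\<rho> x v)"
    and \<rho>_center: "(\<And>y. bracket x y = 0) \<Longrightarrow> v \<in> V \<Longrightarrow> \<rho> x v = 0"
begin

lemma \<rho>_zero: "v \<in> V \<Longrightarrow> \<rho> 0 v = 0"
  using \<rho>_add[of v 0 0] by simp

lemma \<rho>_diff: "v \<in> V \<Longrightarrow> \<rho> (x - y) v = \<rho> x v - \<rho> y v"
  using \<rho>_add[of v "x - y" y] by simp

lemma \<rho>_sum: "v \<in> V \<Longrightarrow> \<rho> (sum g A) v = (\<Sum>i\<in>A. \<rho> (g i) v)"
  by (induction A rule: infinite_finite_induct) (simp_all add: \<rho>_zero \<rho>_add)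

text \<open>An ideal complementary to the derived ideal has all its brackets in the intersection,
  which is 0. It is therefore central and acts by 0.\<close>

lemma acts_as_commutators:
  "\<exists>y \<in> span {bracket a b |a b. True}. \<forall>v\<in>V. \<rho> x v = \<rho> y v"
proof -
  let ?D = "span {bracket a b |a b. True}"
  have "lie_ideal sg bracket ?D" unfolding lie_ideal_def by (auto intro: span_base)
  from reductive[unfolded reductive_def, rule_format, OF this] obtain J
    where J: "lie_ideal sg bracket J" "?D \<inter> J = {0}" "\<forall>x. \<exists>y\<in>?D. \<exists>z\<in>J. x = y + z"
    by (elim exE conjE)
  obtain y z where yz: "y \<in> ?D" "z \<in> J" "x = y + z" using J(3) by blast
  have "bracket z w = 0" for w
  proof -
    have "bracket w z \<in> ?D \<inter> J" using J(1) yz(2) by (auto simp: lie_ideal_def intro: span_base)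
    then have "bracket w z = 0" unfolding J(2) by simp
    then show ?thesis using bracket_skew[of z w] by simp
  qed
  then have "\<forall>v\<in>V. \<rho> x v = \<rho> y v" using \<rho>_center[of z] by (simp add: yz(3) \<rho>_add)
  then show ?thesis using yz(1) by blast
qed

text \<open>By the Leibniz rule, \<open>\<rho> x - (c + \<alpha>)\<close> sends
  \<open>\<rho> z v\<close> to two terms: in one \<open>z\<close> is replaced by its image under
  \<open>bracket x - \<alpha>\<close>, in the other \<open>v\<close> by its image under
  \<open>\<rho> x - c\<close>. The induction is on the sum of the two nilpotency orders.\<close>

lemma \<rho>_gen_eigen:
  assumes "gen_eigen (bracket x) \<alpha> z" "V.gen_eigen (\<rho> x) c v" "v \<in> V"
  shows "V.gen_eigen (\<rho> x) (c + \<alpha>) (\<rho> z v)"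
proof -
  have *: "V.gen_eigen (\<rho> x) (c + \<alpha>) (\<rho> z v)"
    if "(shift (bracket x) \<alpha> ^^ m) z = 0" "(V.shift (\<rho> x) c ^^ n) v = 0" "v \<in> V" for m n z v
    using that
  proof (induction "m + n" arbitrary: m n z v)
    case 0
    then show ?case by (simp add: \<rho>_zero V.gen_eigen_zero)
  next
    case (Suc k)
    show ?case
    proof (cases "m = 0 \<or> n = 0")
      case True
      then have "\<rho> z v = 0" using Suc.prems by (auto simp: \<rho>_zero V.lin_zero[OF lin_\<rho>])
      then show ?thesis by (simp add: V.gen_eigen_zero)
    next
      case False
      then obtain m' n' where mn: "m = Suc m'" "n = Suc n'" by (metis not0_implies_Suc)
      let ?z = "shift (bracket x) \<alpha> z" and ?v = "V.shift (\<rho> x) c v"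
      have z: "(shift (bracket x) \<alpha> ^^ m') ?z = 0" and v: "(V.shift (\<rho> x) c ^^ n') ?v = 0"
        using Suc.prems mn by (simp_all add: funpow_Suc_right del: funpow.simps)
      have "?v \<in> V" using V.shift_stable[where T = "\<rho> x", OF V(1) \<rho>_stable Suc.prems(3)] .
      then have "V.gen_eigen (\<rho> x) (c + \<alpha>) (\<rho> ?z v)" "V.gen_eigen (\<rho> x) (c + \<alpha>) (\<rho> z ?v)"
        using Suc.hyps(1)[of m' n, OF _ z Suc.prems(2,3)] Suc.hyps(1)[of m n', OF _ Suc.prems(1) v]
          Suc.hyps(2) mn by simp_all
      then have "V.gen_eigen (\<rho> x) (c + \<alpha>) (\<rho> ?z v + \<rho> z ?v)"
        by (rule V.gen_eigen_add[OF lin_\<rho>])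
      also have "\<rho> ?z v + \<rho> z ?v = V.shift (\<rho> x) (c + \<alpha>) (\<rho> z v)"
        using Suc.prems(3)
        by (simp add: shift_def V.shift_def \<rho>_diff \<rho>_scale \<rho>_bracket V.lin_simps[OF lin_\<rho>] V.scale_left_distrib)
      finally show ?thesis by (simp add: V.gen_eigen_shift_iff lin_\<rho>)
    qed
  qed
  then show ?thesis using assms unfolding gen_eigen_def V.gen_eigen_def by blast
qed

section \<open>The trace form of a representation\<close>

definition \<beta> :: "'v set \<Rightarrow> 'a \<Rightarrow> 'a \<Rightarrow> complex" where
  "\<beta> S x y = V.trace S (\<lambda>v. \<rho> x (\<rho> y v))"

context
  fixes S assumes S: "V.independent S" "finite S" "V.span S = V"
begin

lemma S_V: "b \<in> S \<Longrightarrow> b \<in> V"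
  using S(3) V.span_base by blast

lemma trace_commute:
  assumes "V.lin f" "V.lin g" "\<And>v. v \<in> V \<Longrightarrow> f v \<in> V" "\<And>v. v \<in> V \<Longrightarrow> g v \<in> V"
  shows "V.trace S (\<lambda>v. f (g v)) = V.trace S (\<lambda>v. g (f v))"
  using V.trace_comp_commute[OF S(1,2,1,2)] assms S(3) by blast

lemma \<beta>_add: "\<beta> S (x + y) z = \<beta> S x z + \<beta> S y z"
  and \<beta>_scale: "\<beta> S (sg c x) z = c * \<beta> S x z"
  and \<beta>_diff: "\<beta> S (x - y) z = \<beta> S x z - \<beta> S y z"
  using V.trace_cong[of S "\<lambda>v. \<rho> (x + y) (\<rho> z v)" "\<lambda>v. \<rho> x (\<rho> z v) + \<rho> y (\<rho> z v)"]
    V.trace_cong[of S "\<lambda>v. \<rho> (sg c x) (\<rho> z v)" "\<lambda>v. sv c (\<rho> x (\<rho> z v))"]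
    V.trace_cong[of S "\<lambda>v. \<rho> (x - y) (\<rho> z v)" "\<lambda>v. \<rho> x (\<rho> z v) - \<rho> y (\<rho> z v)"]
  by (simp_all add: \<beta>_def \<rho>_add \<rho>_scale \<rho>_diff \<rho>_stable S_V V.trace_add V.trace_scale V.trace_diff S(1))

lemma \<beta>_sym: "\<beta> S x y = \<beta> S y x"
  unfolding \<beta>_def by (rule trace_commute) (simp_all add: lin_\<rho> \<rho>_stable)

lemma \<beta>_zero: "\<beta> S 0 z = 0"
  using \<beta>_add[of 0 0 z] by simp

text \<open>Both sides expand into traces of triple products, which match after a cyclic
  rotation.\<close>

lemma \<beta>_invariant: "\<beta> S (bracket z x) y = - \<beta> S x (bracket z y)"
proof -
  have lin2: "V.lin (\<lambda>v. \<rho> a (\<rho> b v))" for a b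
    by (rule V.linI) (simp_all add: V.lin_simps lin_\<rho>)
  have "\<beta> S (bracket z x) y = V.trace S (\<lambda>v. \<rho> z (\<rho> x (\<rho> y v)) - \<rho> x (\<rho> z (\<rho> y v)))"
    unfolding \<beta>_def by (rule V.trace_cong) (simp add: \<rho>_bracket \<rho>_stable S_V)
  also have "\<dots> = V.trace S (\<lambda>v. \<rho> z (\<rho> x (\<rho> y v))) - V.trace S (\<lambda>v. \<rho> x (\<rho> z (\<rho> y v)))"
    by (rule V.trace_diff[OF S(1)])
  also have "V.trace S (\<lambda>v. \<rho> z (\<rho> x (\<rho> y v))) = V.trace S (\<lambda>v. \<rho> x (\<rho> y (\<rho> z v)))"
    using trace_commute[OF lin_\<rho>[of z] lin2[of x y]] by (simp add: \<rho>_stable)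
  also have "\<dots> - V.trace S (\<lambda>v. \<rho> x (\<rho> z (\<rho> y v)))
      = V.trace S (\<lambda>v. \<rho> x (\<rho> y (\<rho> z v)) - \<rho> x (\<rho> z (\<rho> y v)))"
    by (rule V.trace_diff[OF S(1), symmetric])
  also have "\<dots> = V.trace S (\<lambda>v. sv (- 1) (\<rho> x (\<rho> (bracket z y) v)))"
    by (rule V.trace_cong) (simp add: \<rho>_bracket S_V V.lin_simps[OF lin_\<rho>])
  finally show ?thesis by (simp add: \<beta>_def V.trace_scale[OF S(1)] del: V.scale_minus_left)
qed

text \<open>Cartan's criterion. The operator \<open>y\<close> multiplies the generalized eigenspaces of \<open>\<rho> x\<close> by the
  conjugate eigenvalues; its commutator with \<open>\<rho> z\<close> is again in the image of \<open>\<rho>\<close>, so the trace of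
  \<open>y \<circ> \<rho> x\<close>, which is the sum of the squared absolute values of the eigenvalues, vanishes.\<close>

lemma trace_form_zero_nilpotent:
  assumes zero: "\<And>x y. \<beta> S x y = 0"
  shows "\<exists>n. \<forall>v\<in>V. (\<rho> x ^^ n) v = 0"
proof -
  obtain bs d where bs: "V.triangular (\<rho> x) d bs" "V.span (set bs) = V"
    and gen: "\<And>b. b \<in> set bs \<Longrightarrow> V.gen_eigen (\<rho> x) (d b) b"
    using V.triangular_basis_exists[OF lin_\<rho> V(2) \<rho>_stable V(1)] by blast
  obtain y where y: "V.lin y" "\<And>b. b \<in> set bs \<Longrightarrow> y b = sv (cnj (d b)) b"
    using V.lin_extend[of "set bs" "\<lambda>b. sv (cnj (d b)) b"] V.triangular_independent[OF bs(1)] by blast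
  have bs_V: "b \<in> V" if "b \<in> set bs" for b using bs(2) that V.span_base by blast
  have y_gen: "y v = sv (cnj c) v" if "v \<in> V" "V.gen_eigen (\<rho> x) c v" for v c
    using V.diagonal_on_gen_eigen[OF lin_\<rho> bs(1) gen y] bs(2) that by blast
  have y_V: "y v \<in> V" if "v \<in> V" for v
  proof -
    have "v \<in> V.span (set bs)" using that bs(2) by simp
    then show ?thesis
    proof (induction rule: V.span_induct_alt)
      case base
      show ?case by (simp add: V.lin_zero y(1) V.subspace_0 V(1))
    next
      case (step c b w)
      then show ?case by (simp add: V.lin_simps y bs_V V.subspace_add V.subspace_scale V(1))
    qed
  qed
  \<comment> \<open>For a generalized eigenvector \<open>a\<close> of \<open>bracket x\<close>, the
    operator \<open>\<rho> a\<close> raises eigenvalues of \<open>\<rho> x\<close> by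
    \<open>e a\<close>. As conjugation is additive, its commutator with \<open>y\<close> is
    \<open>cnj (e a)\<close> times \<open>\<rho> a\<close>.\<close>
  have comm: "\<exists>z'. \<forall>v\<in>V. y (\<rho> z v) - \<rho> z (y v) = \<rho> z' v" for z
  proof -
    obtain cs e where cs: "span (set cs) = UNIV" "\<And>a. a \<in> set cs \<Longrightarrow> gen_eigen (bracket x) (e a) a"
      using triangular_basis_exists[OF lin_bracket _ UNIV_I subspace_UNIV, of x] span_Basis finite_Basis by blast
    have "z \<in> span (set cs)" using cs(1) by simp
    then show ?thesis
    proof (induction rule: span_induct_alt)
      case base
      show ?case by (rule exI[of _ 0]) (simp add: \<rho>_zero y_V V.lin_simps[OF y(1)])
    next
      case (step c a w)
      then obtain w' where w': "\<forall>v\<in>V. y (\<rho> w v) - \<rho> w (y v) = \<rho> w' v" by blast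
      have a: "y (\<rho> a v) - \<rho> a (y v) = sv (cnj (e a)) (\<rho> a v)" if "v \<in> V" for v
      proof -
        have "v \<in> V.span (set bs)" using that bs(2) by simp
        then show ?thesis
        proof (induction rule: V.span_induct_alt)
          case base
          show ?case by (simp add: V.lin_simps[OF y(1)] V.lin_simps[OF lin_\<rho>])
        next
          case (step k b u)
          have "y (\<rho> a b) = sv (cnj (d b + e a)) (\<rho> a b)"
            using y_gen[OF \<rho>_stable \<rho>_gen_eigen[OF cs(2) gen]] \<open>a \<in> set cs\<close> step(1) bs_V by blast
          moreover have "y b = sv (cnj (d b)) b" using y step by blast
          ultimately have b: "y (\<rho> a b) - \<rho> a (y b) = sv (cnj (e a)) (\<rho> a b)"
            by (simp add: V.lin_simps[OF lin_\<rho>] V.scale_left_distrib)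
          have "y (\<rho> a (sv k b + u)) - \<rho> a (y (sv k b + u))
              = sv k (y (\<rho> a b) - \<rho> a (y b)) + (y (\<rho> a u) - \<rho> a (y u))"
            by (simp add: V.lin_simps[OF y(1)] V.lin_simps[OF lin_\<rho>] V.scale_right_diff_distrib)
          then show ?case
            by (simp only: b step(2)) (simp add: V.lin_simps[OF lin_\<rho>] V.scale_right_distrib V.scale_left_commute)
        qed
      qed
      have "y (\<rho> (sg c a + w) v) - \<rho> (sg c a + w) (y v) = \<rho> (sg (c * cnj (e a)) a + w') v" if "v \<in> V" for v
      proof -
        have "y (\<rho> (sg c a + w) v) - \<rho> (sg c a + w) (y v)
            = sv c (y (\<rho> a v) - \<rho> a (y v)) + (y (\<rho> w v) - \<rho> w (y v))"
          using that y_V by (simp add: \<rho>_add \<rho>_scale V.lin_simps[OF y(1)] V.scale_right_diff_distrib)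
        then show ?thesis using a[OF that] w' that by (simp add: \<rho>_add \<rho>_scale)
      qed
      then show ?case by blast
    qed
  qed
  \<comment> \<open>For \<open>z = [a, b]\<close>, cyclicity of the trace gives the trace of the
    commutator of \<open>y\<close> and \<open>\<rho> a\<close> followed by \<open>\<rho> b\<close>,
    which is a value of the trace form.\<close>
  have tr0: "V.trace S (\<lambda>v. y (\<rho> z v)) = 0" if "z \<in> span {bracket a b |a b. True}" for z
    using that
  proof (induction rule: span_induct_alt)
    case base
    have "V.trace S (\<lambda>v. y (\<rho> 0 v)) = V.trace S (\<lambda>v. 0)"
      by (rule V.trace_cong) (simp add: \<rho>_zero S_V V.lin_zero[OF y(1)])
    then show ?case by (simp add: V.trace_zero S(1))
  next
    case (step c z w)
    then obtain a b where z: "z = bracket a b" by blast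
    obtain a' where a': "\<forall>v\<in>V. y (\<rho> a v) - \<rho> a (y v) = \<rho> a' v" using comm by blast
    have lin_yb: "V.lin (\<lambda>v. y (\<rho> b v))"
      by (rule V.linI) (simp_all add: V.lin_simps y(1) lin_\<rho>)
    have "V.trace S (\<lambda>v. y (\<rho> z v)) = V.trace S (\<lambda>v. y (\<rho> a (\<rho> b v)) - y (\<rho> b (\<rho> a v)))"
      by (rule V.trace_cong) (simp add: z \<rho>_bracket S_V V.lin_simps[OF y(1)])
    also have "\<dots> = V.trace S (\<lambda>v. y (\<rho> a (\<rho> b v))) - V.trace S (\<lambda>v. y (\<rho> b (\<rho> a v)))"
      by (rule V.trace_diff[OF S(1)])
    also have "V.trace S (\<lambda>v. y (\<rho> b (\<rho> a v))) = V.trace S (\<lambda>v. \<rho> a (y (\<rho> b v)))"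
      using trace_commute[OF lin_yb lin_\<rho>[of a]] by (simp add: \<rho>_stable y_V)
    also have "V.trace S (\<lambda>v. y (\<rho> a (\<rho> b v))) - V.trace S (\<lambda>v. \<rho> a (y (\<rho> b v)))
        = V.trace S (\<lambda>v. y (\<rho> a (\<rho> b v)) - \<rho> a (y (\<rho> b v)))"
      by (rule V.trace_diff[OF S(1), symmetric])
    also have "\<dots> = \<beta> S a' b"
      unfolding \<beta>_def by (rule V.trace_cong) (simp add: a' \<rho>_stable S_V)
    finally have "V.trace S (\<lambda>v. y (\<rho> z v)) = 0" using zero by simp
    moreover have "V.trace S (\<lambda>v. y (\<rho> (sg c z + w) v)) = V.trace S (\<lambda>v. sv c (y (\<rho> z v)) + y (\<rho> w v))"
      by (rule V.trace_cong) (simp add: \<rho>_add \<rho>_scale S_V V.lin_simps[OF y(1)])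
    ultimately show ?case using step by (simp add: V.trace_add V.trace_scale S(1))
  qed
  have "V.trace S (\<lambda>v. y (\<rho> x v)) = 0"
  proof -
    obtain z where z: "z \<in> span {bracket a b |a b. True}" "\<forall>v\<in>V. \<rho> x v = \<rho> z v"
      using acts_as_commutators by blast
    have "V.trace S (\<lambda>v. y (\<rho> x v)) = V.trace S (\<lambda>v. y (\<rho> z v))"
      by (rule V.trace_cong) (simp add: z(2) S_V)
    then show ?thesis using tr0[OF z(1)] by simp
  qed
  moreover have "V.trace S (\<lambda>v. y (\<rho> x v)) = V.trace (set bs) (\<lambda>v. y (\<rho> x v))"
  proof (rule V.trace_basis_independent[OF S(1,2)])
    show "V.lin (\<lambda>v. y (\<rho> x v))" by (rule V.linI) (simp_all add: V.lin_simps y(1) lin_\<rho>)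
  qed (use V.triangular_independent[OF bs(1)] bs(2) S(3) y_V \<rho>_stable in auto)
  ultimately have "(\<Sum>b\<leftarrow>bs. cnj (d b) * d b) = 0"
    using V.trace_triangular[OF V.triangular_comp_diagonal[OF y bs(1)]] by simp
  then have "complex_of_real (\<Sum>b\<in>set bs. (cmod (d b))\<^sup>2) = 0"
    using V.triangular_independent[OF bs(1)]
    by (simp add: sum_list_distinct_conv_sum_set complex_norm_square mult.commute del: of_real_power)
  then have "(\<Sum>b\<in>set bs. (cmod (d b))\<^sup>2) = 0" using of_real_eq_0_iff by blast
  then have "d b = 0" if "b \<in> set bs" for b
    using that by (subst (asm) sum_nonneg_eq_0_iff) auto
  then show ?thesis using V.triangular_nilpotent[OF lin_\<rho> bs(1)] bs(2) by blast
qed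


text \<open>Engel's theorem: an element of \<open>V\<close> that \<open>\<rho>\<close> maps into the annihilated vectors is annihilated by
  all commutators, hence by everything.\<close>

lemma nilpotent_imp_trivial:
  assumes nil: "\<And>x. \<exists>n. \<forall>v\<in>V. (\<rho> x ^^ n) v = 0" and "v \<in> V"
  shows "\<rho> x v = 0"
proof -
  \<comment> \<open>\<open>N\<close> is the kernel of the representation on \<open>V\<close>.
    Starting the chain there, nilpotency of \<open>bracket x\<close> is needed only modulo
    \<open>N\<close>.\<close>
  define N where "N = {x. \<forall>v\<in>V. \<rho> x v = 0}"
  have N: "subspace N" by (rule subspaceI) (simp_all add: N_def \<rho>_zero \<rho>_add \<rho>_scale)
  have N_ideal: "bracket x y \<in> N" "bracket y x \<in> N" if "x \<in> N" for x y
    using that by (simp_all add: N_def \<rho>_bracket \<rho>_stable V.lin_zero[OF lin_\<rho>])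
  have ad_nil: "\<exists>n. (bracket x ^^ n) z \<in> N" for x z
  proof -
    \<comment> \<open>The action of an iterated bracket expands into terms with \<open>i\<close>
      factors \<open>\<rho> x\<close> to the left of \<open>\<rho> z\<close> and \<open>j\<close> to
      the right, where \<open>i + j = n\<close>.\<close>
    have *: "\<rho> ((bracket x ^^ n) z) v = 0"
      if "\<And>i j. i + j = n \<Longrightarrow> (\<rho> x ^^ i) (\<rho> z ((\<rho> x ^^ j) v)) = 0" "v \<in> V" for n z v
      using that
    proof (induction n arbitrary: z)
      case 0
      then show ?case using "0.prems"(1)[of 0 0] by simp
    next
      case (Suc n)
      have "(\<rho> x ^^ i) (\<rho> (bracket x z) ((\<rho> x ^^ j) v)) = 0" if "i + j = n" for i j
      proof -
        have "(\<rho> x ^^ i) (\<rho> (bracket x z) ((\<rho> x ^^ j) v))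
            = (\<rho> x ^^ Suc i) (\<rho> z ((\<rho> x ^^ j) v)) - (\<rho> x ^^ i) (\<rho> z ((\<rho> x ^^ Suc j) v))"
          using V.funpow_stable[where T = "\<rho> x" and U = V, OF \<rho>_stable Suc.prems(2)]
          by (simp add: \<rho>_bracket V.lin_diff[OF V.lin_funpow[OF lin_\<rho>]] funpow_swap1)
        then show ?thesis using Suc.prems(1)[of "Suc i" j] Suc.prems(1)[of i "Suc j"] that by simp
      qed
      then show ?case using Suc by (simp add: funpow_Suc_right del: funpow.simps)
    qed
    obtain m where m: "\<forall>v\<in>V. (\<rho> x ^^ m) v = 0" using nil by blast
    have zero: "(\<rho> x ^^ i) v = 0" if "m \<le> i" "v \<in> V" for i v
    proof -
      have "(\<rho> x ^^ i) v = (\<rho> x ^^ (i - m)) ((\<rho> x ^^ m) v)"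
        using funpow_add[of "i - m" m "\<rho> x"] that by simp
      then show ?thesis using m that V.funpow_zero[OF lin_\<rho>] by simp
    qed
    \<comment> \<open>With exponent \<open>m + m\<close>, one of the two outer powers of
      \<open>\<rho> x\<close> is at least \<open>m\<close>, hence zero on \<open>V\<close>.\<close>
    have "(bracket x ^^ (m + m)) z \<in> N"
      unfolding N_def
    proof (intro CollectI ballI)
      fix v assume v: "v \<in> V"
      show "\<rho> ((bracket x ^^ (m + m)) z) v = 0"
      proof (rule *[OF _ v])
        fix i j assume ij: "i + j = m + m"
        have jV: "(\<rho> x ^^ j) v \<in> V" by (rule V.funpow_stable[where T = "\<rho> x", OF \<rho>_stable v])
        show "(\<rho> x ^^ i) (\<rho> z ((\<rho> x ^^ j) v)) = 0"
        proof (cases "m \<le> j")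
          case True
          then show ?thesis using zero v
            by (simp add: V.lin_zero[OF lin_\<rho>] V.funpow_zero[OF lin_\<rho>])
        qed (use zero[of i] ij \<rho>_stable[OF jV] in auto)
      qed
    qed
    then show ?thesis by blast
  qed
  have chain: "subnormal_chain N UNIV"
  proof -
    have sub: "subspace M \<and> N \<subseteq> M \<and> (\<forall>x\<in>M. \<forall>y\<in>M. bracket x y \<in> M)" if "subnormal_chain N M" for M
      using subnormal_chain_subalgebra[OF that N] N_ideal by blast
    \<comment> \<open>A chain of greatest dimension ends at the whole Lie algebra: otherwise
      \<open>engel_step\<close>, for \<open>bracket\<close> modulo \<open>M\<close>, produces a
      vector extending it.\<close>
    define k where "k = (GREATEST k. \<exists>M. subnormal_chain N M \<and> dim M = k)"
    have bound: "k \<le> card Basis" if "\<exists>M. subnormal_chain N M \<and> dim M = k" for k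
      using that dim_subset_UNIV dimension_def by auto
    have "\<exists>M. subnormal_chain N M \<and> dim M = dim N" using subnormal_chain.base by blast
    from GreatestI_nat[of "\<lambda>k. \<exists>M. subnormal_chain N M \<and> dim M = k", OF this bound]
    obtain M where M: "subnormal_chain N M" "dim M = k" unfolding k_def by blast
    have "M = UNIV"
    proof (rule ccontr)
      assume "M \<noteq> UNIV"
      then have "M \<subset> UNIV" by blast
      have "\<exists>y\<in>UNIV. y \<notin> M \<and> (\<forall>x\<in>M. bracket x y \<in> M)"
      proof (rule engel_step[where \<sigma> = bracket and su = sg and N = N])
        show "\<exists>n. (bracket x ^^ n) u \<in> M" if "x \<in> M" for x u
          using ad_nil sub[OF M(1)] by blast
        show "bracket x (bracket y u) = bracket y (bracket x u) + bracket (bracket x y) u" for x y u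
          by (simp add: bracket_bracket_left)
        show "bracket x u \<in> M" if "x \<in> N" for x u
          using sub[OF M(1)] N_ideal(1)[OF that] by blast
      qed (use sub[OF M(1)] M(1) N N_ideal \<open>M \<subset> UNIV\<close> vector_space_axioms
          in \<open>auto simp: bracket_add_left bracket_scale_left\<close>)
      then obtain y where y: "y \<notin> M" "\<And>x. x \<in> M \<Longrightarrow> bracket x y \<in> M" by blast
      then have "subnormal_chain N (span (insert y M))" by (rule subnormal_chain.step[OF M(1)])
      then have "dim (span (insert y M)) \<le> k"
        unfolding k_def by (intro Greatest_le_nat[OF _ bound]) blast+
      moreover have "dim M < dim (span (insert y M))"
      proof (rule dim_psubset)
        have "M \<subseteq> span (insert y M)" "y \<in> span (insert y M)" using span_superset by blast+
        moreover have "span M = M" using sub[OF M(1)] span_eq_iff by blast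
        ultimately show "span M \<subset> span (span (insert y M))"
          unfolding span_span using y(1) by blast
      qed
      ultimately show False using M(2) by simp
    qed
    then show ?thesis using M(1) by simp
  qed
  define V0 where "V0 = {v\<in>V. \<forall>x. \<rho> x v = 0}"
  have V0: "V.subspace V0"
    by (rule V.subspaceI)
      (auto simp: V0_def V.subspace_0 V.subspace_add V.subspace_scale V(1) V.lin_simps[OF lin_\<rho>])
  have "V0 = V"
  proof (rule ccontr)
    assume "V0 \<noteq> V"
    then have "V0 \<subset> V" by (auto simp: V0_def)
    have "\<exists>u\<in>V. u \<notin> V0 \<and> (\<forall>x\<in>UNIV. \<rho> x u \<in> V0)"
    proof (rule engel_step[where \<sigma> = \<rho> and su = sv and N = N])
      show "\<exists>n. (\<rho> x ^^ n) u \<in> V0" if "u \<in> V" for x u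
        using nil[of x] that V.subspace_0[OF V0] by metis
    qed (use chain N N_ideal \<open>V0 \<subset> V\<close> V0 V.vector_space_axioms \<rho>_stable
        in \<open>auto simp: \<rho>_add \<rho>_scale \<rho>_bracket N_def V.subspace_0 V0_def V.lin_zero[OF lin_\<rho>] V(1)\<close>)
    then obtain u where u: "u \<in> V" "u \<notin> V0" "\<And>x. \<rho> x u \<in> V0" by blast
    have "\<rho> z u = 0" if "z \<in> span {bracket a b |a b. True}" for z
      using that
    proof (induction rule: span_induct_alt)
      case (step c z w)
      then obtain a b where "z = bracket a b" by blast
      then have "\<rho> z u = 0" using u by (simp add: \<rho>_bracket V0_def)
      then show ?case using step u by (simp add: \<rho>_add \<rho>_scale)
    qed (simp add: \<rho>_zero u)
    then have "u \<in> V0" using acts_as_commutators u(1) unfolding V0_def by force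
    then show False using u by blast
  qed
  then show ?thesis using assms(2) unfolding V0_def by blast
qed

end

section \<open>The Casimir operator of the trace form\<close>

context
  fixes S E J
  assumes S: "V.independent S" "finite S" "V.span S = V"
    and J: "lie_ideal sg bracket J" "\<And>x. x \<in> J \<Longrightarrow> (\<And>y. \<beta> S x y = 0) \<Longrightarrow> x = 0"
      "\<And>x. \<exists>y z. (\<forall>w. \<beta> S y w = 0) \<and> z \<in> J \<and> x = y + z"
    and E: "independent E" "finite E" "span E = J"
begin

text \<open>\<open>J\<close> is a complement of the radical of the trace form, so pairing with the
  basis \<open>E\<close> of \<open>J\<close> detects everything.\<close>

lemma \<beta>_nondeg: "x \<in> J \<Longrightarrow> (\<And>f. f \<in> E \<Longrightarrow> \<beta> S x f = 0) \<Longrightarrow> x = 0"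
proof (rule J(2))
  fix y assume x: "x \<in> J" "\<And>f. f \<in> E \<Longrightarrow> \<beta> S x f = 0"
  have *: "\<beta> S z x = 0" if "z \<in> span E" for z
    using that
  proof (induction rule: span_induct_alt)
    case (step c z w)
    then show ?case using x(2)[of z] \<beta>_sym[OF S, of z x] by (simp add: \<beta>_add \<beta>_scale S)
  qed (simp add: \<beta>_zero S)
  obtain r z where "\<forall>w. \<beta> S r w = 0" "z \<in> J" "y = r + z" using J(3) by blast
  then have "\<beta> S y x = 0" using * E(3) by (simp add: \<beta>_add S)
  then show "\<beta> S x y = 0" using \<beta>_sym[OF S] by simp
qed

context
  fixes \<delta>
  assumes \<delta>: "\<And>e. e \<in> E \<Longrightarrow> \<delta> e \<in> J" "\<And>e f. e \<in> E \<Longrightarrow> f \<in> E \<Longrightarrow> \<beta> S (\<delta> e) f = (if f = e then 1 else 0)"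
begin

text \<open>The quadratic Casimir operator of \<open>J\<close>; \<open>E\<close> and
  \<open>\<delta>\<close> are dual bases for the trace form.\<close>

definition casimir :: "'v \<Rightarrow> 'v" where
  "casimir v = (\<Sum>e\<in>E. \<rho> e (\<rho> (\<delta> e) v))"

lemma expand_E: "z \<in> J \<Longrightarrow> (\<Sum>f\<in>E. sg (\<beta> S (\<delta> f) z) f) = z"
proof -
  assume z: "z \<in> J"
  have "\<beta> S (\<delta> f) z = coord E f z" if "f \<in> E" for f
  proof -
    have "z \<in> span E" using z E by simp
    then show ?thesis
    proof (induction rule: span_induct_alt)
      case base
      show ?case by (simp add: \<beta>_sym[OF S, of "\<delta> f"] \<beta>_zero[OF S] coord_linear E(1))
    next
      case (step c x y)
      then show ?case using \<delta>(2)[OF that step(1)] that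
        by (simp add: \<beta>_sym[OF S, of "\<delta> f"] \<beta>_add \<beta>_scale S coord_linear coord_basis E(1))
    qed
  qed
  then show ?thesis using sum_coord[OF E(1,2), of z] z E(3) by simp
qed

lemma expand_\<delta>: "z \<in> J \<Longrightarrow> (\<Sum>f\<in>E. sg (\<beta> S z f) (\<delta> f)) = z"
proof -
  assume z: "z \<in> J"
  have sub: "subspace J" using J(1) by (simp add: lie_ideal_def)
  let ?w = "(\<Sum>f\<in>E. sg (\<beta> S z f) (\<delta> f)) - z"
  have "?w = 0"
  proof (rule \<beta>_nondeg)
    show "?w \<in> J" using z \<delta>(1) sub by (intro subspace_diff subspace_sum subspace_scale) auto
    fix e assume e: "e \<in> E"
    have "\<beta> S (\<Sum>f\<in>E. sg (\<beta> S z f) (\<delta> f)) e = (\<Sum>f\<in>E. \<beta> S z f * \<beta> S (\<delta> f) e)"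
      using E(2) by (induction E rule: finite_induct) (simp_all add: \<beta>_zero \<beta>_add \<beta>_scale S)
    also have "\<dots> = (\<Sum>f\<in>E. if f = e then \<beta> S z f else 0)"
      by (rule sum.cong) (use \<delta>(2) e in auto)
    also have "\<dots> = \<beta> S z e" using e E(2) by simp
    finally show "\<beta> S ?w e = 0" by (simp add: \<beta>_diff S)
  qed
  then show ?thesis by simp
qed

lemma lin_casimir: "V.lin casimir"
  unfolding casimir_def
  by (rule V.linI) (simp_all add: V.lin_simps[OF lin_\<rho>] sum.distrib V.scale_sum_right)

lemma casimir_stable: "v \<in> V \<Longrightarrow> casimir v \<in> V"
  unfolding casimir_def by (intro V.subspace_sum V(1) \<rho>_stable)

text \<open>Each dual pair contributes 1, so the trace is the dimension of \<open>J\<close>.\<close>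

lemma trace_casimir: "V.trace S casimir = of_nat (card E)"
proof -
  have "V.trace S casimir = (\<Sum>e\<in>E. \<beta> S e (\<delta> e))"
    unfolding casimir_def[abs_def] \<beta>_def by (rule V.trace_sum[OF S(1)])
  also have "\<dots> = (\<Sum>e\<in>E. 1)"
    by (rule sum.cong) (use \<delta>(2) \<beta>_sym[OF S] in auto)
  finally show ?thesis by simp
qed

text \<open>Expanding \<open>[x, e]\<close> in \<open>E\<close> and \<open>[x, \<delta> e]\<close>
  in the dual basis gives coefficient matrices that are negative transposes of each other, by
  invariance. The two double sums cancel.\<close>

lemma casimir_commute:
  assumes v: "v \<in> V"
  shows "\<rho> x (casimir v) = casimir (\<rho> x v)"
proof -
  have J_ideal: "bracket x y \<in> J" if "y \<in> J" for y using J(1) that by (simp add: lie_ideal_def)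
  have E_J: "e \<in> J" if "e \<in> E" for e using E(3) that span_base by blast
  have 1: "\<rho> (bracket x e) (\<rho> (\<delta> e) v) = (\<Sum>f\<in>E. sv (\<beta> S (\<delta> f) (bracket x e)) (\<rho> f (\<rho> (\<delta> e) v)))"
    if "e \<in> E" for e
    by (subst expand_E[OF J_ideal[OF E_J[OF that]], symmetric])
      (simp add: \<rho>_sum \<rho>_scale \<rho>_stable v)
  have 2: "\<rho> (bracket x (\<delta> e)) v = (\<Sum>f\<in>E. sv (\<beta> S (bracket x (\<delta> e)) f) (\<rho> (\<delta> f) v))" if "e \<in> E" for e
    by (subst expand_\<delta>[OF J_ideal[OF \<delta>(1)[OF that]], symmetric])
      (simp add: \<rho>_sum \<rho>_scale \<rho>_stable v)
  have "\<rho> x (casimir v) - casimir (\<rho> x v) = (\<Sum>e\<in>E. \<rho> (bracket x e) (\<rho> (\<delta> e) v) + \<rho> e (\<rho> (bracket x (\<delta> e)) v))"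
    by (simp add: casimir_def V.lin_simps[OF lin_\<rho>] \<rho>_bracket \<rho>_stable v flip: sum_subtractf)
  also have "\<dots> = (\<Sum>e\<in>E. \<Sum>f\<in>E. sv (\<beta> S (\<delta> f) (bracket x e)) (\<rho> f (\<rho> (\<delta> e) v)))
      + (\<Sum>e\<in>E. \<Sum>f\<in>E. sv (\<beta> S (bracket x (\<delta> e)) f) (\<rho> e (\<rho> (\<delta> f) v)))"
    by (simp add: 1 2 sum.distrib V.lin_simps[OF lin_\<rho>])
  also have "(\<Sum>e\<in>E. \<Sum>f\<in>E. sv (\<beta> S (bracket x (\<delta> e)) f) (\<rho> e (\<rho> (\<delta> f) v)))
      = (\<Sum>e\<in>E. \<Sum>f\<in>E. sv (\<beta> S (bracket x (\<delta> f)) e) (\<rho> f (\<rho> (\<delta> e) v)))"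
    by (rule sum.swap)
  finally show ?thesis by (simp add: \<beta>_invariant S flip: sum.distrib)
qed

end
end

text \<open>Fitting decomposition with respect to the Casimir operator of the trace form of \<open>V\<close>; its trace
  is nonzero, so its generalized kernel is a smaller module.\<close>

lemma module_projection_exists:
  assumes "v \<in> V" "\<rho> x v \<noteq> 0"
  obtains P V0 where "V.lin P" "V.subspace V0" "V0 \<subset> V" "\<And>x v. v \<in> V0 \<Longrightarrow> \<rho> x v \<in> V0"
    "\<And>v. v \<in> V \<Longrightarrow> v - P v \<in> V0" "\<And>v. v \<in> V \<Longrightarrow> P v \<in> V.span {\<rho> x u |x u. u \<in> V}"
    "\<And>x v. v \<in> V \<Longrightarrow> P (\<rho> x v) = \<rho> x (P v)" "\<And>v. v \<in> V \<Longrightarrow> (\<And>x. \<rho> x v = 0) \<Longrightarrow> P v = 0"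
proof -
  obtain S where S: "finite S" "V.independent S" "V.span S = V"
    using V.fin_dim_basis_exists[OF V(2,1)] by blast
  note S' = S(2,1,3)
  \<comment> \<open>The radical of the trace form is an ideal by invariance; reductivity supplies
    the complement \<open>J\<close>.\<close>
  define R where "R = {x. \<forall>y. \<beta> S x y = 0}"
  have "subspace R" by (rule subspaceI) (simp_all add: R_def \<beta>_zero \<beta>_add \<beta>_scale S')
  then have "lie_ideal sg bracket R" by (simp add: lie_ideal_def R_def \<beta>_invariant S')
  from reductive[unfolded reductive_def, rule_format, OF this] obtain J
    where J: "lie_ideal sg bracket J" "R \<inter> J = {0}" "\<forall>x. \<exists>y\<in>R. \<exists>z\<in>J. x = y + z"
    by (elim exE conjE)
  have sub: "subspace J" using J(1) by (simp add: lie_ideal_def)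
  have "fin_dim J" using finite_Basis span_Basis by blast
  then obtain E where E: "finite E" "independent E" "span E = J"
    using fin_dim_basis_exists sub by blast
  have J2: "x = 0" if "x \<in> J" "\<And>y. \<beta> S x y = 0" for x using J(2) that by (auto simp: R_def)
  have J3: "\<exists>y z. (\<forall>w. \<beta> S y w = 0) \<and> z \<in> J \<and> x = y + z" for x
    using J(3) unfolding R_def by blast
  have nondeg: "x = 0" if "x \<in> span E" "\<And>f. f \<in> E \<Longrightarrow> \<beta> S x f = 0" for x
    using \<beta>_nondeg[OF S' J(1) J2 J3 E(2,1,3)] that E(3) by blast
  have "E \<noteq> {}"
  proof
    assume "E = {}"
    then have "J = {0}" using E(3) by simp
    \<comment> \<open>If \<open>J = 0\<close>, the trace form vanishes, and Cartan's criterion with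
      Engel's theorem makes the action trivial, against the assumption.\<close>
    then have "\<beta> S x y = 0" for x y using J3[of x] by (auto simp: \<beta>_zero \<beta>_add S')
    then show False
      using nilpotent_imp_trivial[OF S' trace_form_zero_nilpotent[OF S']] assms by blast
  qed
  obtain \<delta> where "\<forall>e\<in>E. \<delta> e \<in> span E \<and> (\<forall>f\<in>E. \<beta> S (\<delta> e) f = (if f = e then 1 else 0))"
    using dual_basis_exists[OF E(2,1), of "\<beta> S"] nondeg by (auto simp: \<beta>_add \<beta>_scale S')
  then have \<delta>: "\<And>e. e \<in> E \<Longrightarrow> \<delta> e \<in> J" "\<And>e f. e \<in> E \<Longrightarrow> f \<in> E \<Longrightarrow> \<beta> S (\<delta> e) f = (if f = e then 1 else 0)"
    using E(3) by auto
  define \<Omega> where "\<Omega> = casimir E \<delta>"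
  note casimir_hyps = S' J(1) J2 J3 E(2,1,3) \<delta>
  have \<Omega>: "V.lin \<Omega>" "\<And>v. v \<in> V \<Longrightarrow> \<Omega> v \<in> V" "\<And>x v. v \<in> V \<Longrightarrow> \<rho> x (\<Omega> v) = \<Omega> (\<rho> x v)"
    "V.trace S \<Omega> = of_nat (card E)"
    unfolding \<Omega>_def
    using lin_casimir[OF casimir_hyps] casimir_stable[OF casimir_hyps] casimir_commute[OF casimir_hyps]
      trace_casimir[OF casimir_hyps] by blast+
  obtain bs d where bs: "V.triangular \<Omega> d bs" "V.span (set bs) = V"
    and gen: "\<And>b. b \<in> set bs \<Longrightarrow> V.gen_eigen \<Omega> (d b) b"
    using V.triangular_basis_exists[OF \<Omega>(1) V(2) \<Omega>(2) V(1)] by blast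
  have bs_V: "b \<in> V" if "b \<in> set bs" for b using bs(2) that V.span_base by blast
  have V_induct: "Q v" if "v \<in> V" "Q 0" "\<And>c b w. b \<in> set bs \<Longrightarrow> Q w \<Longrightarrow> w \<in> V \<Longrightarrow> Q (sv c b + w)" for Q v
  proof -
    have "v \<in> V.span (set bs)" using that(1) bs(2) by simp
    then have "v \<in> V \<and> Q v"
    proof (induction rule: V.span_induct_alt)
      case (step c x y)
      then show ?case using that(3) bs_V V(1) by (simp add: V.subspace_add V.subspace_scale)
    qed (use that(2) V(1) V.subspace_0 in blast)
    then show ?thesis ..
  qed
  \<comment> \<open>\<open>h\<close> separates the eigenvalue 0 from all others, so on
    \<open>V\<close> the map \<open>P\<close> is the projection along the generalized kernel of the
    Casimir operator.\<close>
  define h :: "complex \<Rightarrow> complex" where "h c = (if c = 0 then 0 else 1)" for c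
  obtain P where P: "V.lin P" "\<And>b. b \<in> set bs \<Longrightarrow> P b = sv (h (d b)) b"
    using V.lin_extend[of "set bs" "\<lambda>b. sv (h (d b)) b"] V.triangular_independent[OF bs(1)] by blast
  have P_gen: "P v = sv (h c) v" if "v \<in> V" "V.gen_eigen \<Omega> c v" for v c
    using V.diagonal_on_gen_eigen[OF \<Omega>(1) bs(1) gen P] bs(2) that by blast
  have gen_\<rho>: "V.gen_eigen \<Omega> c (\<rho> x v)" if "V.gen_eigen \<Omega> c v" "v \<in> V" for c x v
  proof -
    have "(V.shift \<Omega> c ^^ n) (\<rho> x v) = \<rho> x ((V.shift \<Omega> c ^^ n) v) \<and> (V.shift \<Omega> c ^^ n) v \<in> V" for n
    proof (induction n)
      case (Suc n)
      then have "V.shift \<Omega> c ((V.shift \<Omega> c ^^ n) v) \<in> V"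
        using V.shift_stable[where T = \<Omega>, OF V(1) \<Omega>(2)] by blast
      moreover have "V.shift \<Omega> c (\<rho> x w) = \<rho> x (V.shift \<Omega> c w)" if "w \<in> V" for w
        using that by (simp add: V.shift_def V.lin_simps[OF lin_\<rho>] \<Omega>(3))
      ultimately show ?case using Suc by simp
    qed (use that in simp)
    then show ?thesis using that(1) V.lin_zero[OF lin_\<rho>] unfolding V.gen_eigen_def by metis
  qed
  define V0 where "V0 = {v\<in>V. V.gen_eigen \<Omega> 0 v}"
  have V0: "V.subspace V0"
    using V.subspace_inter[OF V(1) V.subspace_gen_eigen[OF \<Omega>(1), of 0]] by (simp add: V0_def Int_def)
  \<comment> \<open>If all eigenvalues were 0, the trace would be 0, but it is the positive integer
    \<open>card E\<close>.\<close>
  have "V0 \<noteq> V"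
  proof
    assume "V0 = V"
    then have "V.gen_eigen \<Omega> 0 b" if "b \<in> set bs" for b using bs_V[OF that] by (auto simp: V0_def)
    then have "d b = 0" if "b \<in> set bs" for b
      using V.triangular_gen_eigen_eq[OF \<Omega>(1) bs(1) that] that by blast
    then have "V.trace (set bs) \<Omega> = 0" using V.trace_triangular[OF bs(1)] by (simp cong: map_cong)
    moreover have "V.trace S \<Omega> = V.trace (set bs) \<Omega>"
      by (rule V.trace_basis_independent[OF S(2,1)])
        (use V.triangular_independent[OF bs(1)] bs(2) S(3) \<Omega> in auto)
    ultimately show False using \<Omega>(4) \<open>E \<noteq> {}\<close> E(1) by simp
  qed
  then have V0_V: "V0 \<subset> V" by (auto simp: V0_def)
  have V0_stable: "\<rho> x v \<in> V0" if "v \<in> V0" for x v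
    using that gen_\<rho> \<rho>_stable by (simp add: V0_def)
  have P_V0: "v - P v \<in> V0" if "v \<in> V" for v
    using that
  proof (rule V_induct)
    fix c b w assume b: "b \<in> set bs" and w: "w - P w \<in> V0"
    have "b - P b \<in> V0"
    proof (cases "d b = 0")
      case True
      then show ?thesis using P(2)[OF b] gen[OF b] bs_V[OF b] by (simp add: h_def V0_def)
    qed (use P(2)[OF b] V.subspace_0[OF V0] in \<open>simp add: h_def\<close>)
    moreover have "sv c b + w - P (sv c b + w) = sv c (b - P b) + (w - P w)"
      by (simp add: V.lin_simps[OF P(1)] V.scale_right_diff_distrib)
    ultimately show "sv c b + w - P (sv c b + w) \<in> V0"
      using w V.subspace_add[OF V0] V.subspace_scale[OF V0] by metis
  qed (simp add: V.lin_zero[OF P(1)] V.subspace_0[OF V0])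
  \<comment> \<open>A basis vector with nonzero eigenvalue is an image under the Casimir operator,
    hence a sum of vectors \<open>\<rho> e u\<close> with \<open>u\<close> in
    \<open>V\<close>.\<close>
  have P_span: "P v \<in> V.span {\<rho> x u |x u. u \<in> V}" if "v \<in> V" for v
    using that
  proof (rule V_induct)
    fix c b w assume b: "b \<in> set bs" and w: "P w \<in> V.span {\<rho> x u |x u. u \<in> V}"
    have "P b \<in> V.span {\<rho> x u |x u. u \<in> V}"
    proof (cases "d b = 0")
      case False
      then obtain w where "w \<in> V" "V.shift \<Omega> 0 w = b"
        using V.gen_eigen_shift_surj[OF \<Omega>(1) V(1) \<Omega>(2) False bs_V[OF b] gen[OF b]] by blast
      then have "b = (\<Sum>e\<in>E. \<rho> e (\<rho> (\<delta> e) w))"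
        by (simp add: V.shift_def \<Omega>_def casimir_def[OF casimir_hyps])
      moreover have "(\<Sum>e\<in>E. \<rho> e (\<rho> (\<delta> e) w)) \<in> V.span {\<rho> x u |x u. u \<in> V}"
        using \<rho>_stable[OF \<open>w \<in> V\<close>] by (intro V.span_sum V.span_base) blast
      ultimately have "b \<in> V.span {\<rho> x u |x u. u \<in> V}" by (simp only:)
      then show ?thesis using P(2)[OF b] V.span_scale by simp
    qed (use P(2)[OF b] V.span_zero in \<open>simp add: h_def\<close>)
    then show "P (sv c b + w) \<in> V.span {\<rho> x u |x u. u \<in> V}"
      using w by (simp add: V.lin_simps[OF P(1)] V.span_add V.span_scale)
  qed (simp add: V.lin_zero[OF P(1)] V.span_zero)
  have P_\<rho>: "P (\<rho> x v) = \<rho> x (P v)" if "v \<in> V" for x v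
    using that
  proof (rule V_induct)
    fix c b w assume b: "b \<in> set bs" and w: "P (\<rho> x w) = \<rho> x (P w)" "w \<in> V"
    have "P (\<rho> x b) = \<rho> x (P b)"
      using P_gen[OF \<rho>_stable gen_\<rho>, OF bs_V[OF b] gen[OF b] bs_V[OF b]] P(2)[OF b]
      by (simp add: V.lin_simps[OF lin_\<rho>])
    then show "P (\<rho> x (sv c b + w)) = \<rho> x (P (sv c b + w))"
      using w by (simp add: V.lin_simps[OF lin_\<rho>] V.lin_simps[OF P(1)])
  qed (simp add: V.lin_zero[OF P(1)] V.lin_zero[OF lin_\<rho>])
  have P_inv: "P v = 0" if "v \<in> V" "\<And>x. \<rho> x v = 0" for v
  proof -
    have "\<Omega> v = 0" using that by (simp add: \<Omega>_def casimir_def[OF casimir_hyps] V.lin_zero[OF lin_\<rho>])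
    then have "(V.shift \<Omega> 0 ^^ 1) v = 0" by (simp add: V.shift_def)
    then have "V.gen_eigen \<Omega> 0 v" unfolding V.gen_eigen_def by blast
    then show ?thesis using P_gen[OF that(1)] by (simp add: h_def)
  qed
  show ?thesis by (rule that[OF P(1) V0 V0_V V0_stable P_V0 P_span P_\<rho> P_inv])
qed

end

text \<open>The projection \<open>P\<close> reduces \<open>V\<close> to the smaller module
  \<open>V0\<close>: its image lies in the span of the vectors \<open>\<rho> x u\<close> and
  contains no nonzero invariants, so both assertions pass from \<open>V0\<close> to
  \<open>V\<close>.\<close>

theorem reductive_rep_decomposition:
  assumes "reductive_rep sg bracket Basis sv \<rho> V"
  shows "(\<forall>v\<in>V. \<exists>w\<in>V. (\<forall>x. \<rho> x w = 0) \<and> v - w \<in> module.span sv {\<rho> x u |x u. u \<in> V}) \<and>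
    (\<forall>v\<in>V. (\<forall>x. \<rho> x v = 0) \<longrightarrow> v \<in> module.span sv {\<rho> x u |x u. u \<in> V} \<longrightarrow> v = 0)"
  using assms
proof (induction "vector_space.dim sv V" arbitrary: V rule: less_induct)
  case less
  interpret reductive_rep sg bracket Basis sv \<rho> V by (rule less.prems)
  let ?D = "\<lambda>W. V.span {\<rho> x u |x u. u \<in> W}"
  show ?case
  proof (cases "\<forall>x. \<forall>v\<in>V. \<rho> x v = 0")
    case True
    then have "?D V \<subseteq> {0}" by (intro V.span_minimal) auto
    then show ?thesis using True V.span_zero by force
  next
    case False
    then obtain x v where xv: "v \<in> V" "\<rho> x v \<noteq> 0" by blast
    obtain P V0 where P: "V.lin P" and V0: "V.subspace V0" "V0 \<subset> V" "\<And>x v. v \<in> V0 \<Longrightarrow> \<rho> x v \<in> V0"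
      and P': "\<And>v. v \<in> V \<Longrightarrow> v - P v \<in> V0" "\<And>v. v \<in> V \<Longrightarrow> P v \<in> ?D V"
        "\<And>x v. v \<in> V \<Longrightarrow> P (\<rho> x v) = \<rho> x (P v)" "\<And>v. v \<in> V \<Longrightarrow> (\<And>x. \<rho> x v = 0) \<Longrightarrow> P v = 0"
      using module_projection_exists[OF xv] by blast
    have sub: "v \<in> V" if "v \<in> V0" for v using that V0 by blast
    have fin: "V.fin_dim V0" using V(2) V0(2) by blast
    have rep: "reductive_rep sg bracket Basis sv \<rho> V0"
      by (rule reductive_rep.intro[OF lie_algebra_axioms finite_dimensional_vector_space_axioms
            V.complex_space_axioms])
        (rule reductive_rep_axioms.intro[OF reductive lin_\<rho> V0(1) fin V0(3) \<rho>_add[OF sub]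
            \<rho>_scale[OF sub] \<rho>_bracket[OF sub] \<rho>_center[OF _ sub]])
    have dim: "V.dim V0 < V.dim V" using V.dim_less_if_psubset[OF V(2,1) V0(1,2)] .
    note IH = less.hyps[OF dim rep]
    have D: "?D V0 \<subseteq> ?D V" using sub by (intro V.span_mono) blast
    show ?thesis
    proof (intro conjI ballI impI)
      fix v assume v: "v \<in> V"
      obtain w where w: "w \<in> V0" "\<forall>x. \<rho> x w = 0" "v - P v - w \<in> ?D V0" using IH P'(1)[OF v] by blast
      then have "(v - P v - w) + P v \<in> ?D V" using D P'(2)[OF v] by (intro V.span_add) auto
      then show "\<exists>w\<in>V. (\<forall>x. \<rho> x w = 0) \<and> v - w \<in> ?D V" using w sub by (auto simp: algebra_simps)
    next
      fix v assume v: "v \<in> V" "\<forall>x. \<rho> x v = 0" "v \<in> ?D V"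
      \<comment> \<open>Subtracting \<open>P\<close> commutes with the action and maps
        \<open>V\<close> into \<open>V0\<close>, so it maps \<open>?D V\<close> into
        \<open>?D V0\<close>. It fixes \<open>v\<close>, as \<open>P\<close> kills
        invariants.\<close>
      have "u - P u \<in> ?D V0" if "u \<in> ?D V" for u
        using that
      proof (induction rule: V.span_induct_alt)
        case base
        show ?case by (simp add: V.lin_zero[OF P] V.span_zero)
      next
        case (step c u w)
        then obtain x z where z: "z \<in> V" "u = \<rho> x z" by blast
        have "u - P u = \<rho> x (z - P z)" using z P'(3) by (simp add: V.lin_simps[OF lin_\<rho>])
        moreover have "\<rho> x (z - P z) \<in> ?D V0" using P'(1)[OF z(1)] by (intro V.span_base) blast
        ultimately have "u - P u \<in> ?D V0" by (simp only:)
        then have "sv c (u - P u) + (w - P w) \<in> ?D V0"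
          using step(2) by (intro V.span_add V.span_scale)
        moreover have "sv c u + w - P (sv c u + w) = sv c (u - P u) + (w - P w)"
          by (simp add: V.lin_simps[OF P] V.scale_right_diff_distrib)
        ultimately show ?case by (simp only:)
      qed
      from this[OF v(3)] have "v \<in> ?D V0" using P'(4)[OF v(1) v(2)[rule_format]] by simp
      moreover have "v \<in> V0" using P'(1)[OF v(1)] P'(4)[OF v(1) v(2)[rule_format]] by simp
      ultimately show "v = 0" using IH v(2) by blast
    qed
  qed
qed

section \<open>The complex of cyclic cochains\<close>

text \<open>Insertion of a first argument matches the list constructor, so identities between
  cochains can be proved by induction on the argument list.\<close>

definition contract :: "'a \<Rightarrow> ('a list \<Rightarrow> 'b) \<Rightarrow> 'a list \<Rightarrow> 'b" where
  "contract a C = (\<lambda>ys. C (a # ys))"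

lemma contract_apply: "contract a C ys = C (a # ys)"
  by (simp add: contract_def)

lemma omit_0: "omit 0 (x # ys) = ys" and omit_Suc: "omit (Suc i) (x # ys) = x # omit i ys"
  by (simp_all add: omit_def)

lemma length_omit: "i < length ys \<Longrightarrow> length (omit i ys) = length ys - 1"
  by (auto simp: omit_def)

context lie_algebra
begin

abbreviation L :: "'a \<Rightarrow> ('a list \<Rightarrow> 'a) \<Rightarrow> 'a list \<Rightarrow> 'a" where
  "L \<equiv> lie_action bracket"

abbreviation d :: "('a list \<Rightarrow> 'a) \<Rightarrow> 'a list \<Rightarrow> 'a" where
  "d \<equiv> chevalley_d scale bracket"

definition d1 :: "('a list \<Rightarrow> 'a) \<Rightarrow> 'a list \<Rightarrow> 'a" where
  "d1 C ys = (\<Sum>i<length ys. scale ((- 1) ^ i) (bracket (ys ! i) (C (omit i ys))))"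

definition d2 :: "('a list \<Rightarrow> 'a) \<Rightarrow> 'a list \<Rightarrow> 'a" where
  "d2 C ys = (\<Sum>j<length ys. \<Sum>i<j.
     scale ((- 1) ^ (i + j)) (C (bracket (ys ! i) (ys ! j) # omit i (omit j ys))))"

text \<open>In terms of a basis and its dual basis, the sum of the products \<open>e\<^sup>i \<and> L\<^sub>e\<^sub>i C\<close>.\<close>

definition wedge_L :: "('a list \<Rightarrow> 'a) \<Rightarrow> 'a list \<Rightarrow> 'a" where
  "wedge_L C ys = (\<Sum>i<length ys. scale ((- 1) ^ i) (L (ys ! i) C (omit i ys)))"

lemma d_split: "d C ys = d1 C ys + d2 C ys"
  by (simp add: chevalley_d_def d1_def d2_def)

lemma L_Nil: "L x C [] = bracket x (C [])"
  by (simp add: lie_action_def)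

text \<open>The relation \<open>[L x, \<iota> a] = \<iota> [x, a]\<close> of Cartan's calculus,
  evaluated on arguments.\<close>

lemma L_Cons: "L x C (a # ys) = L x (contract a C) ys - C (bracket x a # ys)"
  by (simp add: lie_action_def contract_def sum.lessThan_Suc_shift algebra_simps del: sum.lessThan_Suc)

lemma L_add: "L x (C + D) = L x C + L x D"
  and L_scale: "L x (\<lambda>ys. scale c (C ys)) = (\<lambda>ys. scale c (L x C ys))"
  and L_diff: "L x (C - D) = L x C - L x D"
  by (auto simp: fun_eq_iff lie_action_def bracket_add_right bracket_diff_right bracket_scale_right
      sum.distrib sum_subtractf scale_sum_right algebra_simps)

lemma L_zero: "L x (\<lambda>_. 0) = (\<lambda>_. 0)"
  by (simp add: fun_eq_iff lie_action_def bracket_zero_right)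

lemma d_zero: "d (\<lambda>_. 0) = (\<lambda>_. 0)"
  by (simp add: fun_eq_iff chevalley_d_def bracket_zero_right)

lemma d_add: "d (C + D) = d C + d D"
  by (simp add: fun_eq_iff chevalley_d_def bracket_add_right sum.distrib scale_right_distrib)

lemma d_scale: "d (\<lambda>ys. scale c (C ys)) = (\<lambda>ys. scale c (d C ys))"
  by (simp add: fun_eq_iff chevalley_d_def bracket_scale_right scale_right_distrib scale_sum_right mult.commute)

lemma d_diff: "d (C - D) = d C - d D"
  using d_add[of "C - D" D] by (simp add: algebra_simps)

lemma d_Nil: "d C [] = 0"
  by (simp add: chevalley_d_def)

end

context quadratic_lie_algebra
begin

section \<open>The invariant form\<close>

lemma B_add_left: "B (x + y) z = B x z + B y z"
  and B_scale_left: "B (scale c x) z = c * B x z"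
  and B_add_right: "B z (x + y) = B z x + B z y"
  and B_scale_right: "B z (scale c x) = c * B z x"
  using linear_form_left linear_form_right by (simp_all add: Vector_Spaces.linear_iff)

lemma B_zero_left: "B 0 z = 0" and B_zero_right: "B z 0 = 0"
  using B_scale_left[of 0 0 z] B_scale_right[of z 0 0] by simp_all

lemma B_neg_left: "B (- x) z = - B x z" and B_neg_right: "B z (- x) = - B z x"
  using B_scale_left[of "- 1" x z] B_scale_right[of z "- 1" x] by simp_all

lemma B_diff_left: "B (x - y) z = B x z - B y z" and B_diff_right: "B z (x - y) = B z x - B z y"
  using B_add_left[of "x - y" y z] B_add_right[of z "x - y" y] by simp_all

lemma B_bracket: "B (bracket y c) z = B c (bracket z y)"
  by (subst bracket_skew, subst (2) bracket_skew) (simp add: B_neg_left B_neg_right form_invariant)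

section \<open>Cyclic cochains by recursion on the degree\<close>

text \<open>The recursive form of \<open>cyclic_cochains scale B k\<close>. Antisymmetry in the first two arguments of all
  iterated contractions gives the antisymmetry of \<open>hat B C\<close> in all its arguments except the last one; the
  last clause, for the contractions of degree 1, supplies the exchange of its last two arguments.\<close>

fun cyc :: "nat \<Rightarrow> ('a list \<Rightarrow> 'a) \<Rightarrow> bool" where
  "cyc 0 C \<longleftrightarrow> (\<forall>a ys. C (a # ys) = 0)"
| "cyc (Suc k) C \<longleftrightarrow> C [] = 0 \<and> (\<forall>a. cyc k (contract a C)) \<and> (\<forall>ys. lin (\<lambda>a. C (a # ys))) \<and>
     (\<forall>a b ys. C (a # b # ys) = - C (b # a # ys)) \<and>
     (k = 0 \<longrightarrow> (\<forall>a b. B (C [a]) b = - B (C [b]) a))"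

lemma lin_const_zero: "lin (\<lambda>a. 0)"
  by (rule linI) simp_all

declare cyc.simps(2) [simp del]

lemma cyc_SucI:
  assumes "C [] = 0" "\<And>a. cyc k (contract a C)" "\<And>ys. lin (\<lambda>a. C (a # ys))"
    "\<And>a b ys. C (a # b # ys) = - C (b # a # ys)" "\<And>a b. k = 0 \<Longrightarrow> B (C [a]) b = - B (C [b]) a"
  shows "cyc (Suc k) C"
  unfolding cyc.simps(2) using assms by blast

lemma cyc_Nil: "cyc (Suc k) C \<Longrightarrow> C [] = 0"
  and cyc_Suc_contract: "cyc (Suc k) C \<Longrightarrow> cyc k (contract a C)"
  unfolding cyc.simps(2) by blast+

lemma cyc_degree_1: "cyc (Suc 0) C \<Longrightarrow> B (C [a]) b = - B (C [b]) a"
  unfolding cyc.simps(2) by blast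

lemma cyc_lin: "cyc k C \<Longrightarrow> lin (\<lambda>a. C (a # ys))"
  by (cases k) (simp_all add: lin_const_zero cyc.simps(2))

lemma cyc_alt: "cyc k C \<Longrightarrow> C (a # b # ys) = - C (b # a # ys)"
proof (cases k)
  case (Suc j)
  assume "cyc k C"
  then show ?thesis unfolding Suc cyc.simps(2) by blast
qed simp

lemma cyc_contract: "cyc k C \<Longrightarrow> cyc (k - 1) (contract a C)"
  by (cases k) (simp_all add: contract_def cyc_Suc_contract[unfolded contract_def])

lemma cyc_zero: "cyc k (\<lambda>_. 0)"
  by (induction k) (auto intro!: cyc_SucI simp: contract_def lin_const_zero B_zero_left)

lemma cyc_add: "cyc k C \<Longrightarrow> cyc k D \<Longrightarrow> cyc k (C + D)"
proof (induction k arbitrary: C D)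
  case (Suc k)
  show ?case
  proof (rule cyc_SucI)
    have *: "contract a (C + D) = contract a C + contract a D" for a by (simp add: contract_def fun_eq_iff)
    show "cyc k (contract a (C + D))" for a
      unfolding * by (intro Suc.IH cyc_Suc_contract Suc.prems)
    show "lin (\<lambda>a. (C + D) (a # ys))" for ys
      by (intro linI) (simp_all add: Suc.prems[THEN cyc_lin, THEN lin_add]
          Suc.prems[THEN cyc_lin, THEN lin_scale] algebra_simps)
    show "(C + D) (a # b # ys) = - (C + D) (b # a # ys)" for a b ys
      using cyc_alt[OF Suc.prems(1), of a b ys] cyc_alt[OF Suc.prems(2), of a b ys] by simp
    show "B ((C + D) [a]) b = - B ((C + D) [b]) a" if "k = 0" for a b
      using cyc_degree_1[of C a b] cyc_degree_1[of D a b] Suc.prems that by (simp add: B_add_left)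
  qed (use Suc.prems in \<open>simp add: cyc_Nil\<close>)
qed auto

lemma cyc_scale: "cyc k C \<Longrightarrow> cyc k (\<lambda>ys. scale c (C ys))"
proof (induction k arbitrary: C)
  case (Suc k)
  show ?case
  proof (rule cyc_SucI)
    have *: "contract a (\<lambda>ys. scale c (C ys)) = (\<lambda>ys. scale c (contract a C ys))" for a
      by (simp add: contract_def)
    show "cyc k (contract a (\<lambda>ys. scale c (C ys)))" for a
      unfolding * by (intro Suc.IH cyc_Suc_contract Suc.prems)
    show "lin (\<lambda>a. scale c (C (a # ys)))" for ys
      by (intro linI) (simp_all add: Suc.prems[THEN cyc_lin, THEN lin_add]
          Suc.prems[THEN cyc_lin, THEN lin_scale] algebra_simps)
    show "scale c (C (a # b # ys)) = - scale c (C (b # a # ys))" for a b ys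
      using cyc_alt[OF Suc.prems(1), of a b ys] by simp
    show "B (scale c (C [a])) b = - B (scale c (C [b])) a" if "k = 0" for a b
      using cyc_degree_1[of C a b] Suc.prems that by (simp add: B_scale_left)
  qed (use Suc.prems in \<open>simp add: cyc_Nil\<close>)
qed auto

lemma cyc_diff: "cyc k C \<Longrightarrow> cyc k D \<Longrightarrow> cyc k (C - D)"
  using cyc_add[of k C "\<lambda>ys. scale (- 1) (D ys)"] cyc_scale[of k D "- 1"] by (simp add: plus_fun_def fun_diff_def)

lemma cyc_length: "cyc k C \<Longrightarrow> length ys \<noteq> k \<Longrightarrow> C ys = 0"
proof (induction k arbitrary: C ys)
  case 0
  then show ?case by (cases ys) auto
next
  case (Suc k)
  show ?case
  proof (cases ys)
    case (Cons a zs)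
    then show ?thesis using Suc.IH[OF cyc_Suc_contract[OF Suc.prems(1)], of zs a] Suc.prems(2) by (simp add: contract_apply)
  qed (use cyc_Nil[OF Suc.prems(1)] in simp)
qed

text \<open>With the first argument \<open>a\<close> fixed, induction carries \<open>b\<close> to
  the second place; exchanging \<open>a\<close> and \<open>b\<close> adds one sign. Degree 1 is the
  last clause of \<open>cyc\<close>.\<close>

lemma cyc_rotate:
  "cyc k C \<Longrightarrow> length ys = k \<Longrightarrow> B (C ys) b = (- 1) ^ k * B (C (butlast (b # ys))) (last (b # ys))"
proof (induction k arbitrary: C ys)
  case (Suc k)
  then obtain a zs where ys: "ys = a # zs" "length zs = k" by (cases ys) auto
  show ?case
  proof (cases "k = 0")
    case True
    then have "B (C [a]) b = - B (C [b]) a" using Suc.prems(1) cyc_degree_1 by blast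
    then show ?thesis using ys True by simp
  next
    case False
    then have "zs \<noteq> []" using ys by auto
    have "B (contract a C zs) b = (- 1) ^ k * B (contract a C (butlast (b # zs))) (last (b # zs))"
      by (rule Suc.IH[OF cyc_Suc_contract[OF Suc.prems(1)] ys(2)])
    moreover have "C (a # b # butlast zs) = - C (b # a # butlast zs)" by (rule cyc_alt[OF Suc.prems(1)])
    ultimately show ?thesis using ys \<open>zs \<noteq> []\<close> by (simp add: contract_apply B_neg_left)
  qed
qed simp

lemma cyc_swap:
  "cyc k C \<Longrightarrow> length ys = k \<Longrightarrow> i < j \<Longrightarrow> j < k \<Longrightarrow> C (ys[i := ys ! j, j := ys ! i]) = - C ys"
proof (induction k arbitrary: C ys i j)
  case (Suc k)
  then obtain a zs where ys: "ys = a # zs" "length zs = k" by (cases ys) auto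
  obtain j' where j: "j = Suc j'" using Suc.prems by (cases j) auto
  show ?case
  proof (cases i)
    case (Suc i')
    then show ?thesis using Suc.IH[OF cyc_Suc_contract[OF Suc.prems(1)] ys(2), of i' j' a] Suc.prems(2-) ys j by (simp add: contract_apply)
  next
    case 0
    show ?thesis
    proof (cases j')
      case 0
      then obtain b ws where "zs = b # ws" using ys Suc.prems j by (cases zs) auto
      then show ?thesis using ys j \<open>i = 0\<close> 0 cyc_alt[OF Suc.prems(1), of b a ws] by simp
    next
      case (Suc j'')
      then obtain b ws where zs: "zs = b # ws" using ys Suc.prems j by (cases zs) auto
      let ?c = "ws ! j''"
      \<comment> \<open>The exchange of positions 0 and \<open>j\<close> is an exchange that fixes
        the first argument, conjugated by the exchange of the first two; it costs three
        signs.\<close>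
      have "C (?c # b # ws[j'' := a]) = - C (b # ?c # ws[j'' := a])" by (rule cyc_alt[OF Suc.prems(1)])
      also have "C (b # ?c # ws[j'' := a]) = - C (b # a # ws)"
        using Suc.IH[OF cyc_Suc_contract[OF Suc.prems(1)], of "a # ws" 0 j' b] Suc.prems(2-) ys j zs \<open>j' = Suc j''\<close>
        by (simp add: contract_apply)
      also have "C (b # a # ws) = - C (a # b # ws)" by (rule cyc_alt[OF Suc.prems(1)])
      finally show ?thesis using ys j \<open>i = 0\<close> zs \<open>j' = Suc j''\<close> by simp
    qed
  qed
qed simp

lemma cyc_lin_slot: "cyc k C \<Longrightarrow> i < length ys \<Longrightarrow> lin (\<lambda>y. C (ys[i := y]))"
proof (induction ys arbitrary: k C i)
  case (Cons a ys)
  show ?case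
  proof (cases i)
    case (Suc j)
    then show ?thesis using Cons.IH[OF cyc_contract[OF Cons.prems(1)], of j a] Cons.prems(2)
      by (simp add: contract_apply)
  qed (use cyc_lin[OF Cons.prems(1)] in simp)
qed simp

text \<open>Rotating \<open>a # ys\<close> puts its last entry in front of \<open>a\<close>. One
  exchange restores \<open>a\<close> to the first place and accounts for the sign between the two
  degrees.\<close>

lemma cyclic_cochains_contract:
  assumes "C \<in> cyclic_cochains scale B (Suc k)"
  shows "contract a C \<in> cyclic_cochains scale B k"
proof -
  have zero: "\<And>ys. length ys \<noteq> Suc k \<Longrightarrow> C ys = 0"
    and lin: "\<And>ys i. length ys = Suc k \<Longrightarrow> i < Suc k \<Longrightarrow> lin (\<lambda>y. C (ys[i := y]))"
    and alt: "\<And>ys i j. length ys = Suc k \<Longrightarrow> i < j \<Longrightarrow> j < Suc k \<Longrightarrow>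
        C (ys[i := ys ! j, j := ys ! i]) = - C ys"
    and rot: "\<And>ys. length ys = Suc k + 1 \<Longrightarrow> hat B C ys = (- 1) ^ Suc k * hat B C (last ys # butlast ys)"
    using assms unfolding cyclic_cochains_def cochains_def by blast+
  have "lin (\<lambda>y. contract a C (ys[i := y]))" if "length ys = k" "i < k" for ys i
    using lin[of "a # ys" "Suc i"] that by (simp add: contract_apply)
  moreover have "contract a C (ys[i := ys ! j, j := ys ! i]) = - contract a C ys"
    if "length ys = k" "i < j" "j < k" for ys i j
    using alt[of "a # ys" "Suc i" "Suc j"] that by (simp add: contract_apply)
  moreover have "hat B (contract a C) ys = (- 1) ^ k * hat B (contract a C) (last ys # butlast ys)"
    if len: "length ys = k + 1" for ys
  proof (cases k)
    case 0
    then obtain y where "ys = [y]" using len by (cases ys) auto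
    then show ?thesis using 0 by simp
  next
    case (Suc k')
    then have ne: "ys \<noteq> []" "butlast ys \<noteq> []" using len by (auto simp: butlast_conv_take)
    have "hat B C (a # ys) = (- 1) ^ Suc k * hat B C (last ys # a # butlast ys)"
      using rot[of "a # ys"] len ne by simp
    moreover have "C (last ys # a # butlast (butlast ys)) = - C (a # last ys # butlast (butlast ys))"
      using alt[of "a # last ys # butlast (butlast ys)" 0 1] len Suc by simp
    ultimately show ?thesis using ne by (simp add: hat_def contract_apply B_neg_left)
  qed
  ultimately show ?thesis using zero unfolding cyclic_cochains_def cochains_def
    by (auto simp: contract_apply)
qed

lemma cyclic_cochains_eq: "cyclic_cochains scale B k = {C. cyc k C}"
proof (intro equalityI subsetI)
  fix C assume "C \<in> {C. cyc k C}"
  then have C: "cyc k C" by simp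
  have "hat B C ys = (- 1) ^ k * hat B C (last ys # butlast ys)" if "length ys = k + 1" for ys
  proof -
    have "ys = butlast ys @ [last ys]" using that by (metis Suc_eq_plus1 append_butlast_last_id list.size(3) nat.distinct(1))
    moreover have "length (butlast ys) = k" using that by simp
    ultimately show ?thesis using cyc_rotate[OF C, of "butlast ys" "last ys"] by (simp add: hat_def)
  qed
  then show "C \<in> cyclic_cochains scale B k"
    using cyc_length[OF C] cyc_lin_slot[OF C] cyc_swap[OF C]
    unfolding cyclic_cochains_def cochains_def by auto
next
  fix C assume "C \<in> cyclic_cochains scale B k"
  then have "cyc k C"
  proof (induction k arbitrary: C)
    case 0
    then show ?case by (simp add: cyclic_cochains_def cochains_def)
  next
    case (Suc k)
    have zero: "\<And>ys. length ys \<noteq> Suc k \<Longrightarrow> C ys = 0"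
      and lin: "\<And>ys i. length ys = Suc k \<Longrightarrow> i < Suc k \<Longrightarrow> lin (\<lambda>y. C (ys[i := y]))"
      and alt: "\<And>ys i j. length ys = Suc k \<Longrightarrow> i < j \<Longrightarrow> j < Suc k \<Longrightarrow>
          C (ys[i := ys ! j, j := ys ! i]) = - C ys"
      and rot: "\<And>ys. length ys = Suc k + 1 \<Longrightarrow> hat B C ys = (- 1) ^ Suc k * hat B C (last ys # butlast ys)"
      using Suc.prems unfolding cyclic_cochains_def cochains_def by blast+
    have "lin (\<lambda>a. C (a # ys))" for ys
    proof (cases "length ys = k")
      case True
      then show ?thesis using lin[of "0 # ys" 0] by simp
    next
      case False
      then have "(\<lambda>a. C (a # ys)) = (\<lambda>a. 0)" using zero by auto
      then show ?thesis using lin_const_zero by simp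
    qed
    moreover have "C (a # b # ys) = - C (b # a # ys)" for a b ys
      using alt[of "b # a # ys" 0 1] zero[of "a # b # ys"] zero[of "b # a # ys"]
      by (cases "Suc (length ys) = k") auto
    moreover have "B (C [a]) b = - B (C [b]) a" if "k = 0" for a b
      using rot[of "[a, b]"] that by (simp add: hat_def)
    moreover have "cyc k (contract a C)" for a
      by (rule Suc.IH[OF cyclic_cochains_contract[OF Suc.prems]])
    moreover have "C [] = 0" using zero[of "[]"] by simp
    ultimately show ?case by - (rule cyc_SucI; blast)
  qed
  then show "C \<in> {C. cyc k C}" by simp
qed

section \<open>Recursions for the differential, Cartan's formula and closedness of
  invariants\<close>

lemma cyc_move_front:
  "cyc k C \<Longrightarrow> j < length ys \<Longrightarrow> C (b # omit j ys) = scale ((- 1) ^ j) (C (ys[j := b]))"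
proof (induction ys arbitrary: k C j)
  case (Cons a ys)
  show ?case
  proof (cases j)
    case (Suc i)
    have "C (b # a # omit i ys) = - C (a # b # omit i ys)" by (rule cyc_alt[OF Cons.prems(1)])
    also have "C (a # b # omit i ys) = scale ((- 1) ^ i) (C (a # ys[i := b]))"
      using Cons.IH[OF cyc_contract[OF Cons.prems(1)], of i a] Cons.prems(2) Suc by (simp add: contract_apply)
    finally show ?thesis by (simp add: Suc omit_Suc)
  qed (simp add: omit_0)
qed simp

lemma d1_Cons: "d1 C (x # ys) = bracket x (C ys) - d1 (contract x C) ys"
  by (simp add: d1_def sum.lessThan_Suc_shift omit_0 omit_Suc contract_apply sum_negf del: sum.lessThan_Suc)

text \<open>In the pairs that contain \<open>x\<close>, moving \<open>[x, y]\<close> back to the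
  slot of \<open>y\<close> gives the sum occurring in \<open>L x C\<close>. In the other pairs
  \<open>x\<close> follows the bracket, and exchanging the two gives the contraction with a minus
  sign.\<close>

lemma d2_Cons:
  assumes C: "cyc k C"
  shows "d2 C (x # ys) = (L x C ys - bracket x (C ys)) - d2 (contract x C) ys"
proof -
  have *: "scale ((- 1) ^ j) (C (bracket x (ys ! j) # omit j ys)) = C (ys[j := bracket x (ys ! j)])"
    if "j < length ys" for j
    by (subst cyc_move_front[OF C that]) (simp flip: power_mult_distrib)
  have "d2 C (x # ys) = (\<Sum>j<length ys. scale ((- 1) ^ Suc j) (C (bracket x (ys ! j) # omit j ys)) +
      (\<Sum>i<j. scale ((- 1) ^ (i + j)) (C (bracket (ys ! i) (ys ! j) # x # omit i (omit j ys)))))"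
    by (simp add: d2_def sum.lessThan_Suc_shift omit_0 omit_Suc del: sum.lessThan_Suc)
  also have "\<dots> = (\<Sum>j<length ys. - C (ys[j := bracket x (ys ! j)])) - d2 (contract x C) ys"
    by (simp add: * d2_def contract_apply cyc_alt[OF C, of _ x] sum_negf sum_subtractf)
  finally show ?thesis by (simp add: lie_action_def sum_negf)
qed

text \<open>Cartan's formula on arguments: the terms \<open>bracket x (C ys)\<close> of the two
  recursions cancel.\<close>

lemma d_Cons:
  assumes C: "cyc k C"
  shows "d C (x # ys) = L x C ys - d (contract x C) ys"
  by (simp add: d_split d1_Cons d2_Cons[OF C])

lemma wedge_L_Cons:
  assumes C: "cyc k C"
  shows "wedge_L C (x # ys) = L x C ys - wedge_L (contract x C) ys + (L x C ys - bracket x (C ys))"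
proof -
  have *: "scale ((- 1) ^ i) (C (bracket (ys ! i) x # omit i ys)) = - C (ys[i := bracket x (ys ! i)])"
    if "i < length ys" for i
  proof -
    have "C (bracket (ys ! i) x # omit i ys) = - C (bracket x (ys ! i) # omit i ys)"
      using lin_neg[OF cyc_lin[OF C]] by (subst bracket_skew)
    then show ?thesis by (subst (asm) cyc_move_front[OF C that]) (simp flip: power_mult_distrib)
  qed
  have "wedge_L C (x # ys) = L x C ys - (\<Sum>i<length ys. scale ((- 1) ^ i) (L (ys ! i) C (x # omit i ys)))"
    by (simp add: wedge_L_def sum.lessThan_Suc_shift omit_0 omit_Suc sum_negf del: sum.lessThan_Suc)
  also have "\<dots> = L x C ys - wedge_L (contract x C) ys + (\<Sum>i<length ys. - C (ys[i := bracket x (ys ! i)]))"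
    by (simp add: wedge_L_def L_Cons * scale_right_diff_distrib sum.distrib sum_negf)
  finally show ?thesis by (simp add: lie_action_def sum_negf)
qed

text \<open>Each term of \<open>d2 C\<close> occurs twice in \<open>wedge_L C\<close>, once from
  each of the two bracketed arguments, while the terms of \<open>d1 C\<close> occur once. The proof
  compares recursions instead of rearranging sums.\<close>

lemma wedge_L_eq: "cyc k C \<Longrightarrow> wedge_L C ys + d1 C ys = scale 2 (d C ys)"
proof (induction ys arbitrary: k C)
  case Nil
  then show ?case by (simp add: wedge_L_def d1_def d_Nil)
next
  case (Cons x ys)
  have "scale 2 (d C (x # ys)) = scale 2 (L x C ys) - scale 2 (d (contract x C) ys)"
    by (simp add: d_Cons[OF Cons.prems] scale_right_diff_distrib)
  also have "\<dots> = scale 2 (L x C ys) - (wedge_L (contract x C) ys + d1 (contract x C) ys)"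
    by (simp add: Cons.IH[OF cyc_contract[OF Cons.prems]])
  also have "scale 2 (L x C ys) = L x C ys + L x C ys"
    using scale_left_distrib[of 1 1] by simp
  finally show ?case by (simp add: wedge_L_Cons[OF Cons.prems] d1_Cons)
qed

text \<open>Invariance of \<open>B\<close> turns \<open>B (bracket x (C zs)) z\<close> into
  \<open>B (C zs) (bracket z x)\<close>, and rotation moves \<open>bracket z x\<close> to the first
  argument of \<open>C\<close>, where \<open>L z C\<close> has it. The remaining arguments follow by
  contraction.\<close>

lemma B_d1:
  "cyc k C \<Longrightarrow> length ys = Suc k \<Longrightarrow>
    B (d1 C ys) z = (- 1) ^ Suc k * B (L z C (butlast ys)) (last ys)"
proof (induction k arbitrary: C ys)
  case 0
  then obtain a where "ys = [a]" by (cases ys) auto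
  then show ?case
    by (simp add: d1_def omit_0 L_Nil B_bracket) (subst bracket_skew, simp add: B_neg_right)
next
  case (Suc k)
  then obtain x zs where ys: "ys = x # zs" "length zs = Suc k" by (cases ys) auto
  then have "zs \<noteq> []" by auto
  have "B (d1 (contract x C) zs) z = (- 1) ^ Suc k * B (L z (contract x C) (butlast zs)) (last zs)"
    by (rule Suc.IH[OF cyc_Suc_contract[OF Suc.prems(1)] ys(2)])
  moreover have "B (bracket x (C zs)) z = (- 1) ^ Suc k * B (C (bracket z x # butlast zs)) (last zs)"
    using cyc_rotate[OF Suc.prems(1) ys(2), of "bracket z x"] \<open>zs \<noteq> []\<close> by (simp add: B_bracket)
  ultimately show ?case using ys \<open>zs \<noteq> []\<close>
    by (simp add: d1_Cons L_Cons B_diff_left algebra_simps)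
qed

text \<open>Invariance kills \<open>wedge_L C\<close>, so \<open>d1 C\<close> is twice
  \<open>d C\<close>; by \<open>B_d1\<close> and nondegeneracy it also kills
  \<open>d1 C\<close>.\<close>

lemma invariant_imp_closed:
  assumes C: "cyc k C" and inv: "\<And>x. L x C = (\<lambda>_. 0)"
  shows "d C = (\<lambda>_. 0)"
proof
  fix ys
  have "d1 C ys = 0"
  proof (cases "length ys = Suc k")
    case True
    show ?thesis by (rule form_nondegenerate) (simp add: B_d1[OF C True] inv B_zero_left)
  next
    case False
    then have "C (omit i ys) = 0" if "i < length ys" for i
      using cyc_length[OF C, of "omit i ys"] that by (simp add: length_omit)
    then show ?thesis by (simp add: d1_def bracket_zero_right)
  qed
  moreover have "wedge_L C ys = 0" by (simp add: wedge_L_def inv)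
  ultimately show "d C ys = 0" using wedge_L_eq[OF C, of ys] by simp
qed

section \<open>Lie derivative and differential on cyclic cochains\<close>

lemma contract_L: "contract a (L x C) = L x (contract a C) - contract (bracket x a) C"
  by (simp add: fun_eq_iff contract_apply L_Cons)

lemma cyc_L: "cyc k C \<Longrightarrow> cyc k (L x C)"
proof (induction k arbitrary: C)
  case 0
  then have "contract a C = (\<lambda>_. 0)" for a by (simp add: contract_def)
  then show ?case using 0 by (simp add: L_Cons L_zero)
next
  case (Suc k)
  have "cyc k (contract a (L x C))" for a
    unfolding contract_L by (intro cyc_diff Suc.IH cyc_Suc_contract[OF Suc.prems])
  moreover have "lin (\<lambda>a. L x C (a # ys))" for ys
    unfolding L_Cons
    by (rule linI) (simp_all add: lie_action_def contract_apply bracket_add_right bracket_scale_right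
        lin_add[OF cyc_lin[OF Suc.prems]] lin_scale[OF cyc_lin[OF Suc.prems]] sum.distrib scale_sum_right
        algebra_simps)
  moreover have "L x C (a # b # ys) = - L x C (b # a # ys)" for a b ys
  proof -
    have "contract b (contract a C) = (\<lambda>ys. scale (- 1) (contract a (contract b C) ys))"
      using cyc_alt[OF Suc.prems, of a b] by (simp add: fun_eq_iff contract_apply)
    then have "L x (contract b (contract a C)) ys = - L x (contract a (contract b C)) ys"
      using L_scale[of x "- 1" "contract a (contract b C)"] by simp
    then show ?thesis
      using cyc_alt[OF Suc.prems, of "bracket x a" b ys] cyc_alt[OF Suc.prems, of a "bracket x b" ys]
      by (simp add: L_Cons contract_apply)
  qed
  moreover have "B (L x C [a]) b = - B (L x C [b]) a" if "k = 0" for a b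
  proof -
    have *: "B (C [u]) v = - B (C [v]) u" for u v using cyc_degree_1 Suc.prems that by blast
    have "B (bracket x (C [a])) b = - B (C [a]) (bracket x b)" for a b
      by (simp add: B_bracket) (subst bracket_skew, simp add: B_neg_right)
    then show ?thesis
      using *[of a "bracket x b"] *[of b "bracket x a"] by (simp add: L_Cons L_Nil contract_apply B_diff_left)
  qed
  moreover have "L x C [] = 0" by (simp add: L_Nil cyc_Nil[OF Suc.prems] bracket_zero_right)
  ultimately show ?case by - (rule cyc_SucI; blast)
qed

lemma L_commutator: "cyc k C \<Longrightarrow> L (bracket x y) C ys = L x (L y C) ys - L y (L x C) ys"
proof (induction ys arbitrary: k C)
  case Nil
  then show ?case by (simp add: L_Nil bracket_bracket_left)
next
  case (Cons a ys)
  have "C (bracket (bracket x y) a # ys) = C (bracket x (bracket y a) # ys) - C (bracket y (bracket x a) # ys)"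
    unfolding bracket_bracket_left by (rule lin_diff[OF cyc_lin[OF Cons.prems]])
  moreover have "L (bracket x y) (contract a C) ys = L x (L y (contract a C)) ys - L y (L x (contract a C)) ys"
    by (rule Cons.IH[OF cyc_contract[OF Cons.prems]])
  ultimately show ?case by (simp add: L_Cons contract_L L_diff contract_apply)
qed

lemma L_add_left: "cyc k C \<Longrightarrow> L (x + y) C ys = L x C ys + L y C ys"
proof (induction ys arbitrary: k C)
  case (Cons a ys)
  then show ?case using Cons.IH[OF cyc_contract[OF Cons.prems], of a]
    by (simp add: L_Cons bracket_add_left lin_add[OF cyc_lin[OF Cons.prems]])
qed (simp add: L_Nil bracket_add_left)

lemma L_scale_left: "cyc k C \<Longrightarrow> L (scale c x) C ys = scale c (L x C ys)"
proof (induction ys arbitrary: k C)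
  case (Cons a ys)
  then show ?case using Cons.IH[OF cyc_contract[OF Cons.prems], of a]
    by (simp add: L_Cons bracket_scale_left lin_scale[OF cyc_lin[OF Cons.prems]] scale_right_diff_distrib)
qed (simp add: L_Nil bracket_scale_left)

lemma L_center: "cyc k C \<Longrightarrow> (\<And>y. bracket x y = 0) \<Longrightarrow> L x C ys = 0"
proof (induction ys arbitrary: k C)
  case (Cons a ys)
  then show ?case using Cons.IH[OF cyc_contract[OF Cons.prems(1)], of a]
    by (simp add: L_Cons lin_zero[OF cyc_lin[OF Cons.prems(1)]])
qed (simp add: L_Nil)

lemma contract_d: "cyc k C \<Longrightarrow> contract x (d C) = L x C - d (contract x C)"
  by (simp add: fun_eq_iff contract_apply d_Cons)

text \<open>Expanding both sides by Cartan's formula leaves the commutator relation for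
  \<open>L\<close> and the same identity for a contraction.\<close>

lemma L_d: "cyc k C \<Longrightarrow> L x (d C) ys = d (L x C) ys"
proof (induction ys arbitrary: k C)
  case Nil
  then show ?case by (simp add: L_Nil d_Nil bracket_zero_right)
next
  case (Cons y ys)
  have "L x (d C) (y # ys) = L x (L y C) ys - L x (d (contract y C)) ys - (L (bracket x y) C ys - d (contract (bracket x y) C) ys)"
    by (simp add: L_Cons contract_d[OF Cons.prems] L_diff d_Cons[OF Cons.prems])
  moreover have "d (L x C) (y # ys) = L y (L x C) ys - (d (L x (contract y C)) ys - d (contract (bracket x y) C) ys)"
    by (simp add: d_Cons[OF cyc_L[OF Cons.prems]] contract_L d_diff)
  ultimately show ?case
    using Cons.IH[OF cyc_contract[OF Cons.prems], of y] L_commutator[OF Cons.prems, of x y ys] by simp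
qed

text \<open>Cartan's formula expresses the contractions of \<open>d C\<close> by cochains already
  known to be cyclic. For degree 0, \<open>d C\<close> maps \<open>[a]\<close> to
  \<open>bracket a (C [])\<close>, and the required skewness is the invariance of
  \<open>B\<close>.\<close>

lemma cyc_d: "cyc k C \<Longrightarrow> cyc (Suc k) (d C)"
proof (induction k arbitrary: C)
  case 0
  then have c: "contract a C = (\<lambda>_. 0)" for a by (simp add: contract_def)
  have "lin (\<lambda>a. d C (a # ys))" for ys
    by (rule linI) (simp_all add: d_Cons[OF 0] c d_zero L_add_left[OF 0] L_scale_left[OF 0])
  moreover have "d C (a # b # ys) = - d C (b # a # ys)" for a b ys
    using cyc_L[OF 0, of a] cyc_L[OF 0, of b] by (simp add: d_Cons[OF 0] c d_zero)
  moreover have "B (d C [a]) b = - B (d C [b]) a" for a b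
    by (simp add: d_Cons[OF 0] c d_zero L_Nil B_bracket) (subst bracket_skew, simp add: B_neg_right)
  moreover have "cyc 0 (contract a (d C))" for a
    using cyc_L[OF 0, of a] by (simp add: contract_d[OF 0] c d_zero fun_diff_def)
  moreover have "d C [] = 0" by (rule d_Nil)
  ultimately show ?case by - (rule cyc_SucI; blast)
next
  case (Suc k)
  have "cyc (Suc k) (contract a (d C))" for a
    unfolding contract_d[OF Suc.prems]
    by (intro cyc_diff cyc_L Suc.IH cyc_Suc_contract[OF Suc.prems] Suc.prems)
  moreover have "lin (\<lambda>a. d C (a # ys))" for ys
  proof -
    have "contract (a + b) C = contract a C + contract b C" for a b
      by (simp add: fun_eq_iff contract_apply lin_add[OF cyc_lin[OF Suc.prems]])
    moreover have "contract (scale c a) C = (\<lambda>ys. scale c (contract a C ys))" for c a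
      by (simp add: fun_eq_iff contract_apply lin_scale[OF cyc_lin[OF Suc.prems]])
    ultimately show ?thesis
      by (intro linI) (simp_all add: d_Cons[OF Suc.prems] d_add d_scale L_add_left[OF Suc.prems]
          L_scale_left[OF Suc.prems] scale_right_diff_distrib)
  qed
  moreover have "d C (a # b # ys) = - d C (b # a # ys)" for a b ys
  proof -
    have "contract b (contract a C) = (\<lambda>ys. scale (- 1) (contract a (contract b C) ys))"
      using cyc_alt[OF Suc.prems, of a b] by (simp add: fun_eq_iff contract_apply)
    then have "d (contract b (contract a C)) ys = - d (contract a (contract b C)) ys"
      using d_scale[of "- 1" "contract a (contract b C)"] by simp
    moreover have "C (bracket b a # ys) = - C (bracket a b # ys)"
      by (subst bracket_skew) (rule lin_neg[OF cyc_lin[OF Suc.prems]])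
    ultimately show ?thesis
      using d_Cons[OF cyc_contract[OF Suc.prems, of a], of b ys] d_Cons[OF cyc_contract[OF Suc.prems, of b], of a ys]
      by (simp add: d_Cons[OF Suc.prems] L_Cons)
  qed
  moreover have "d C [] = 0" by (rule d_Nil)
  ultimately show ?case by - (rule cyc_SucI; blast)
qed

end

section \<open>Decomposition of cyclic cochains\<close>

definition fun_scale :: "(complex \<Rightarrow> 'a \<Rightarrow> 'a) \<Rightarrow> complex \<Rightarrow> ('b \<Rightarrow> 'a) \<Rightarrow> 'b \<Rightarrow> 'a" where
  "fun_scale sc c f = (\<lambda>x. sc c (f x))"

lemma (in complex_space) complex_space_fun: "complex_space (fun_scale scale)"
  by unfold_locales (simp_all add: fun_scale_def fun_eq_iff scale_right_distrib scale_left_distrib)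

locale fd_quadratic_lie_algebra = quadratic_lie_algebra scale bracket B +
    finite_dimensional_vector_space scale Basis
  for scale :: "complex \<Rightarrow> 'a::ab_group_add \<Rightarrow> 'a" and bracket B and Basis :: "'a set"
begin

text \<open>All functions on lists form one ambient space, in which the cyclic cochains of each
  degree are a finite-dimensional subspace.\<close>

sublocale F: complex_space "fun_scale scale :: complex \<Rightarrow> ('a list \<Rightarrow> 'a) \<Rightarrow> 'a list \<Rightarrow> 'a"
  by (rule complex_space_fun)

lemma lin_L: "F.lin (L x)"
  by (rule F.linI) (simp_all only: L_add fun_scale_def L_scale)

lemma lin_d: "F.lin d"
  by (rule F.linI) (simp_all only: d_add fun_scale_def d_scale)

lemma subspace_cyc: "F.subspace {C. cyc k C}"
  by (rule F.subspaceI) (auto simp: fun_scale_def cyc_zero[folded zero_fun_def] cyc_add cyc_scale)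

text \<open>A cochain is the sum over the basis of coordinate functionals tensored with its
  contractions. These tensors need not be alternating, but \<open>F.fin_dim\<close> asks only for a
  finite set whose span contains the cochains.\<close>

lemma fin_dim_cyc: "F.fin_dim {C. cyc k C}"
proof (induction k)
  case 0
  let ?f = "\<lambda>c ys. if ys = [] then c else (0::'a)"
  have "C \<in> F.span (?f ` Basis)" if "cyc 0 C" for C
  proof -
    have eq: "C = ?f (C [])" using cyc_length[OF that] by (auto simp: fun_eq_iff)
    have mem: "?f c \<in> F.span (?f ` Basis)" for c
    proof -
      have "c \<in> span Basis" using span_Basis by simp
      then show ?thesis
      proof (induction rule: span_induct_alt)
        case base
        have *: "?f 0 = 0" by (simp add: fun_eq_iff)
        show ?case unfolding * by (rule F.span_zero)
      next
        case (step a b c)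
        have *: "?f (scale a b + c) = fun_scale scale a (?f b) + ?f c" by (simp add: fun_eq_iff fun_scale_def)
        show ?case unfolding * by (intro F.span_add F.span_scale F.span_base imageI step)
      qed
    qed
    show ?thesis by (subst eq) (rule mem)
  qed
  then have "{C. cyc 0 C} \<subseteq> F.span (?f ` Basis)" by blast
  then show ?case using finite_imageI[OF finite_Basis] by blast
next
  case (Suc k)
  then obtain S where S: "finite S" "{C. cyc k C} \<subseteq> F.span S" by blast
  define J where "J b C = (\<lambda>ys. case ys of [] \<Rightarrow> 0 | a # zs \<Rightarrow> scale (coord Basis b a) (C zs))"
    for b :: 'a and C :: "'a list \<Rightarrow> 'a"
  have J: "F.lin (J b)" for b
    by (rule F.linI) (auto simp: J_def fun_eq_iff fun_scale_def scale_right_distrib mult.commute split: list.split)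
  let ?S = "\<Union>b\<in>Basis. J b ` S"
  have "C \<in> F.span ?S" if C: "cyc (Suc k) C" for C
  proof -
    have J_span: "J b D \<in> F.span ?S" if "b \<in> Basis" "D \<in> F.span S" for b D
      using that(2)
    proof (induction rule: F.span_induct_alt)
      case base
      show ?case by (simp only: F.lin_zero[OF J] F.span_zero)
    next
      case (step c x y)
      then have "J b x \<in> F.span ?S" using that(1) by (intro F.span_base) blast
      then show ?case using step(2) by (simp only: F.lin_simps[OF J] F.span_add F.span_scale)
    qed
    have "C ys = (\<Sum>b\<in>Basis. J b (contract b C) ys)" for ys
    proof (cases ys)
      case Nil
      then show ?thesis by (simp add: J_def cyc_Nil[OF C])
    next
      case (Cons a zs)
      have "a = (\<Sum>b\<in>Basis. scale (coord Basis b a) b)"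
        using sum_coord[OF independent_Basis finite_Basis, of a] span_Basis by simp
      then have "C (a # zs) = C ((\<Sum>b\<in>Basis. scale (coord Basis b a) b) # zs)" by simp
      also have "\<dots> = (\<Sum>b\<in>Basis. scale (coord Basis b a) (C (b # zs)))"
        by (simp add: lin_sum[OF cyc_lin[OF C]] lin_scale[OF cyc_lin[OF C]])
      finally show ?thesis by (simp add: Cons J_def contract_apply)
    qed
    moreover have "(\<Sum>b\<in>Basis. f b) ys = (\<Sum>b\<in>Basis. f b ys)" for f :: "'a \<Rightarrow> 'a list \<Rightarrow> 'a" and ys
      by (induction Basis rule: infinite_finite_induct) simp_all
    ultimately have eq: "C = (\<Sum>b\<in>Basis. J b (contract b C))" by (intro ext) (simp only:)
    have mem: "(\<Sum>b\<in>Basis. J b (contract b C)) \<in> F.span ?S"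
      using S(2) cyc_Suc_contract[OF C] by (intro F.span_sum J_span) auto
    show ?thesis by (subst eq) (rule mem)
  qed
  then have "{C. cyc (Suc k) C} \<subseteq> F.span ?S" by blast
  moreover have "finite ?S" using finite_Basis S(1) by simp
  ultimately show ?case by blast
qed

text \<open>A general stable \<open>W\<close> is allowed because both the cyclic cocycles and all
  cyclic cochains are needed as modules.\<close>

lemma reductive_rep_L:
  assumes red: "reductive scale bracket" and W: "F.subspace W" "W \<subseteq> {C. cyc k C}"
    and stable: "\<And>x C. C \<in> W \<Longrightarrow> L x C \<in> W"
  shows "reductive_rep scale bracket Basis (fun_scale scale) L W"
proof (intro reductive_rep.intro reductive_rep_axioms.intro)
  show "F.fin_dim W" using fin_dim_cyc[of k] W(2) by blast
  have cyc: "cyc k C" if "C \<in> W" for C using W(2) that by blast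
  show "L (x + y) C = L x C + L y C" if "C \<in> W" for x y C
    by (simp add: fun_eq_iff L_add_left[OF cyc[OF that]])
  show "L (scale c x) C = fun_scale scale c (L x C)" if "C \<in> W" for c x C
    by (simp add: fun_eq_iff fun_scale_def L_scale_left[OF cyc[OF that]])
  show "L (bracket x y) C = L x (L y C) - L y (L x C)" if "C \<in> W" for x y C
    by (simp add: fun_eq_iff L_commutator[OF cyc[OF that]])
  show "L x C = 0" if "\<And>y. bracket x y = 0" "C \<in> W" for x C
    by (simp add: fun_eq_iff L_center[OF cyc[OF that(2)] that(1)])
qed (use red W(1) stable lin_L in \<open>simp_all add: lie_algebra_axioms
    finite_dimensional_vector_space_axioms F.complex_space_axioms\<close>)

section \<open>Invariant representatives of cyclic classes\<close>

lemma invariant_iff: "invariant_cochain bracket C \<longleftrightarrow> (\<forall>x. L x C = 0)"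
  by (simp add: invariant_cochain_def zero_fun_def)

lemma cocycles_eq: "cyclic_cocycles scale bracket B k = {C. cyc k C \<and> d C = 0}"
  by (auto simp: cyclic_cocycles_def cyclic_cochains_eq zero_fun_def)

lemma subspace_coboundaries: "F.subspace (cyclic_coboundaries scale bracket B k)"
proof (cases k)
  case 0
  then show ?thesis by (simp add: cyclic_coboundaries_def flip: zero_fun_def)
next
  case (Suc j)
  have "F.subspace (d ` {C. cyc j C})"
    by (rule module_hom.subspace_image[OF lin_d[folded module_hom_iff_linear] subspace_cyc])
  then show ?thesis by (simp add: cyclic_coboundaries_def Suc cyclic_cochains_eq)
qed

text \<open>Cartan's formula with \<open>d C = 0\<close> gives the primitive
  \<open>contract x C\<close>. In degree 0 this contraction is 0, so \<open>L x C\<close> is the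
  zero coboundary.\<close>

lemma L_cocycle_coboundary:
  assumes "cyc k C" "d C = 0"
  shows "L x C \<in> cyclic_coboundaries scale bracket B k"
proof -
  have "contract x (d C) = 0" by (simp add: assms(2) contract_def fun_eq_iff)
  then have eq: "L x C = d (contract x C)" using contract_d[OF assms(1), of x] by simp
  show ?thesis
  proof (cases k)
    case 0
    then have "contract x C = (\<lambda>_. 0)" using assms(1) by (simp add: contract_def)
    then show ?thesis by (simp add: eq 0 cyclic_coboundaries_def d_zero)
  next
    case (Suc j)
    then show ?thesis using cyc_Suc_contract assms(1)
      by (simp add: eq cyclic_coboundaries_def cyclic_cochains_eq)
  qed
qed

lemma cohomologous_invariant_exists:
  assumes red: "reductive scale bracket" and C: "cyc k C" "d C = 0"
  shows "\<exists>D. cyc k D \<and> d D = 0 \<and> invariant_cochain bracket D \<and> C - D \<in> cyclic_coboundaries scale bracket B k"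
proof -
  let ?Z = "{C. cyc k C \<and> d C = 0}"
  have sub: "F.subspace ?Z"
    by (rule F.subspaceI)
      (auto simp: F.lin_simps[OF lin_d] F.subspace_0[OF subspace_cyc, simplified]
        cyc_add cyc_scale[folded fun_scale_def])
  have stable: "L x C \<in> ?Z" if "C \<in> ?Z" for x C
  proof -
    have "cyc k C" using that by blast
    then have "d (L x C) = L x (d C)" by (intro ext L_d[symmetric])
    also have "\<dots> = 0" using that by (simp add: F.lin_zero[OF lin_L])
    finally have "d (L x C) = 0" .
    then show ?thesis using that cyc_L by blast
  qed
  have "reductive_rep scale bracket Basis (fun_scale scale) L ?Z"
    by (rule reductive_rep_L[OF red sub _ stable, of k]) auto
  from reductive_rep_decomposition[OF this] C obtain D
    where D: "D \<in> ?Z" "\<forall>x. L x D = 0" "C - D \<in> F.span {L x u |x u. u \<in> ?Z}" by blast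
  \<comment> \<open>The error term of the decomposition of the cocycles is therefore a
    coboundary.\<close>
  have "F.span {L x u |x u. u \<in> ?Z} \<subseteq> cyclic_coboundaries scale bracket B k"
    by (rule F.span_minimal[OF _ subspace_coboundaries]) (auto intro: L_cocycle_coboundary)
  then show ?thesis using D by (auto simp: invariant_iff)
qed

lemma invariant_coboundary_zero:
  assumes red: "reductive scale bracket" and D: "D \<in> cyclic_coboundaries scale bracket B k"
    and inv: "invariant_cochain bracket D"
  shows "D = 0"
proof (cases k)
  case 0
  then show ?thesis using D by (simp add: cyclic_coboundaries_def zero_fun_def)
next
  case (Suc j)
  then obtain E where E: "cyc j E" "D = d E" using D by (auto simp: cyclic_coboundaries_def cyclic_cochains_eq)
  have rep: "reductive_rep scale bracket Basis (fun_scale scale) L {C. cyc i C}" for i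
    by (rule reductive_rep_L[OF red subspace_cyc order_refl]) (simp add: cyc_L)
  obtain E0 where E0: "cyc j E0" "\<forall>x. L x E0 = 0" "E - E0 \<in> F.span {L x u |x u. u \<in> {C. cyc j C}}"
    using reductive_rep_decomposition[OF rep[of j]] E(1) by blast
  \<comment> \<open>The invariant part of the primitive is closed, so only the part in the span of
    Lie derivatives contributes to \<open>D\<close>.\<close>
  have "d E0 = 0" using invariant_imp_closed[OF E0(1)] E0(2) by (simp add: zero_fun_def)
  then have "D = d (E - E0)" by (simp add: d_diff E(2))
  \<comment> \<open>As \<open>d\<close> commutes with \<open>L\<close>, it carries Lie derivatives
    of cochains of degree \<open>j\<close> to Lie derivatives of cochains of degree
    \<open>k\<close>.\<close>
  moreover have "d G \<in> F.span {L x u |x u. u \<in> {C. cyc k C}}"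
    if "G \<in> F.span {L x u |x u. u \<in> {C. cyc j C}}" for G
    using that
  proof (induction rule: F.span_induct_alt)
    case base
    show ?case by (simp only: F.lin_zero[OF lin_d] F.span_zero)
  next
    case (step c u w)
    then obtain x v where v: "cyc j v" "u = L x v" by blast
    have "d u = L x (d v)" unfolding v(2) by (intro ext L_d[OF v(1), symmetric])
    moreover have "cyc k (d v)" using cyc_d[OF v(1)] Suc by simp
    ultimately have "d u \<in> F.span {L x u |x u. u \<in> {C. cyc k C}}" by (intro F.span_base) blast
    then show ?case using step(2) by (simp only: F.lin_simps[OF lin_d] F.span_add F.span_scale)
  qed
  ultimately have "D \<in> F.span {L x u |x u. u \<in> {C. cyc k C}}" using E0(3) by simp
  moreover have "cyc k D" using cyc_d[OF E(1)] Suc E(2) by simp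
  ultimately show ?thesis using reductive_rep_decomposition[OF rep[of k]] inv by (simp add: invariant_iff)
qed

end

theorem proposition8p1p2:
  fixes scale :: "complex \<Rightarrow> 'a::ab_group_add \<Rightarrow> 'a"
    and Basis :: "'a set"
    and bracket :: "'a \<Rightarrow> 'a \<Rightarrow> 'a"
    and B :: "'a \<Rightarrow> 'a \<Rightarrow> complex"
  assumes "finite_dimensional_vector_space scale Basis"
    and "quadratic_lie_algebra scale bracket B"
  shows "(\<forall>k. \<forall>C\<in>cyclic_cochains scale B k.
            invariant_cochain bracket C \<longrightarrow> C \<in> cyclic_cocycles scale bracket B k) \<and>
         (reductive scale bracket \<longrightarrow>
            (\<forall>k. \<forall>\<xi>\<in>cyclic_cohomology scale bracket B k.
               \<exists>!C. C \<in> \<xi> \<and> invariant_cochain bracket C) \<and>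
            (\<forall>k. \<forall>C\<in>cyclic_coboundaries scale bracket B k.
               invariant_cochain bracket C \<longrightarrow> C = (\<lambda>_. 0)))"
proof -
  interpret fd_quadratic_lie_algebra scale bracket B Basis
    using assms by (intro fd_quadratic_lie_algebra.intro)
  have "C \<in> cyclic_cocycles scale bracket B k"
    if "C \<in> cyclic_cochains scale B k" "invariant_cochain bracket C" for k C
    using that invariant_imp_closed[of k C]
    by (simp add: cocycles_eq cyclic_cochains_eq invariant_iff zero_fun_def)
  moreover have "\<exists>!C. C \<in> \<xi> \<and> invariant_cochain bracket C"
    if red: "reductive scale bracket" and \<xi>: "\<xi> \<in> cyclic_cohomology scale bracket B k" for k \<xi>
  proof -
    let ?b = "cyclic_coboundaries scale bracket B k"
    \<comment> \<open>A class is the coset of any cocycle representing it.\<close>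
    obtain C where C: "cyc k C" "d C = 0" and
      \<xi>_eq: "\<xi> = {D. cyc k D \<and> d D = 0 \<and> C - D \<in> ?b}"
      using \<xi> unfolding cyclic_cohomology_def
      by (elim quotientE) (auto simp: cyclic_cohomologous_def cocycles_eq fun_diff_def)
    show ?thesis
    proof (rule ex_ex1I)
      show "\<exists>D. D \<in> \<xi> \<and> invariant_cochain bracket D"
        using cohomologous_invariant_exists[OF red C] \<xi>_eq by blast
    next
      fix D E assume D: "D \<in> \<xi> \<and> invariant_cochain bracket D" and E: "E \<in> \<xi> \<and> invariant_cochain bracket E"
      \<comment> \<open>This difference is \<open>D - E\<close>, an invariant coboundary.\<close>
      then have "(C - E) - (C - D) \<in> ?b"
        using F.subspace_diff[OF subspace_coboundaries] \<xi>_eq by blast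
      moreover have "invariant_cochain bracket (D - E)" using D E by (simp add: invariant_iff L_diff)
      ultimately have "D - E = 0" using invariant_coboundary_zero[OF red, of "D - E" k] by simp
      then show "D = E" by simp
    qed
  qed
  ultimately show ?thesis using invariant_coboundary_zero by (simp add: zero_fun_def)
qed

end
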